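(* Let $(R,\mathfrak m,k)$ be a Noetherian local complete $F$-injective ring of prime characteristic $p$ and of dimension $1$. Assume that the residue field $k$ is algebraically closed and that $R$ is a domain. Then $R$ is regular.
   Context: For a Noetherian local ring $(R,\mathfrak m)$ of prime characteristic $p$, the Frobenius $r\mapsto r^p$ acts on $R$ and its localizations, hence on the Čech complex of a system of parameters, and so induces a natural Frobenius action $F$ (an additive map with $F(rm)=r^pF(m)$) on each local cohomology module $H^i_{\mathfrak m}(R)$. $R$ is $F$-injective if $F$ is injective on $H^i_{\mathfrak m}(R)$ for all $i$. *)

theory Defs
  imports
    "HOL-Algebra.Algebra"
    "HOL-Computational_Algebra.Primes"
    "HOL-Library.Extended_Nat"
begin

section \<open>Noetherian local rings\<close>

locale noetherian_local_ring = noetherian_ring R + cring R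
  for R (structure) and \<mm> +
  assumes maximal: "maximalideal \<mm> R"
    and unique_maximal: "maximalideal I R \<Longrightarrow> I = \<mm>"

text \<open>The kernel of the canonical map from the integers to \<open>R\<close> is generated by \<open>n\<close>.\<close>

definition has_char :: "('a, 'b) ring_scheme \<Rightarrow> nat \<Rightarrow> bool" where
  "has_char R n \<longleftrightarrow> (\<forall>k::nat. [k] \<cdot>\<^bsub>R\<^esub> \<one>\<^bsub>R\<^esub> = \<zero>\<^bsub>R\<^esub> \<longleftrightarrow> n dvd k)"

text \<open>Supremum of the lengths \<open>n\<close> of chains \<open>P\<^sub>0 \<subset> \<dots> \<subset> P\<^sub>n\<close> of prime ideals
  (the zero ring, which has none, gets dimension \<open>0\<close>).\<close>

definition krull_dim :: "('a, 'b) ring_scheme \<Rightarrow> enat" where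
  "krull_dim R = Sup {enat n | n. \<exists>P :: nat \<Rightarrow> 'a set.
     (\<forall>i\<le>n. primeideal (P i) R) \<and> (\<forall>i<n. P i \<subset> P (Suc i))}"

text \<open>\<open>\<mm>\<^sup>0\<close> is the unit ideal, the unit of the monoid of ideals.\<close>

abbreviation ideal_power :: "('a, 'b) ring_scheme \<Rightarrow> 'a set \<Rightarrow> nat \<Rightarrow> 'a set" where
  "ideal_power R I n \<equiv> I [^]\<^bsub>ideals_set R\<^esub> n"

text \<open>Complete means complete and separated: \<open>R\<close> is the limit of the quotients \<open>R/\<mm>\<^sup>n\<close>.\<close>

definition adically_complete :: "('a, 'b) ring_scheme \<Rightarrow> 'a set \<Rightarrow> bool" where
  "adically_complete R I \<longleftrightarrow>
     (\<Inter>n. ideal_power R I n) = {\<zero>\<^bsub>R\<^esub>} \<and>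
     (\<forall>s \<in> (UNIV :: nat set) \<rightarrow> carrier R.
        (\<forall>n. \<exists>N. \<forall>i\<ge>N. \<forall>j\<ge>N. s i \<ominus>\<^bsub>R\<^esub> s j \<in> ideal_power R I n) \<longrightarrow>
        (\<exists>l \<in> carrier R. \<forall>n. \<exists>N. \<forall>i\<ge>N. s i \<ominus>\<^bsub>R\<^esub> l \<in> ideal_power R I n))"

definition regular_local_ring :: "('a, 'b) ring_scheme \<Rightarrow> 'a set \<Rightarrow> bool" where
  "regular_local_ring R \<mm> \<longleftrightarrow> noetherian_local_ring R \<mm> \<and>
     (\<exists>A \<subseteq> carrier R. finite A \<and> enat (card A) = krull_dim R \<and> \<mm> = Idl\<^bsub>R\<^esub> A)"

text \<open>A sequence of \<open>dim R\<close> elements of \<open>\<mm>\<close> generating an \<open>\<mm>\<close>-primary ideal.\<close>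

definition system_of_parameters :: "('a, 'b) ring_scheme \<Rightarrow> 'a set \<Rightarrow> 'a list \<Rightarrow> bool" where
  "system_of_parameters R \<mm> xs \<longleftrightarrow>
     set xs \<subseteq> \<mm> \<and> enat (length xs) = krull_dim R \<and>
     (\<exists>n. ideal_power R \<mm> n \<subseteq> Idl\<^bsub>R\<^esub> (set xs))"


section \<open>Localization at the powers of an element\<close>

text \<open>The pair \<open>(a, m)\<close> stands for the fraction \<open>a/x\<^sup>m\<close>.\<close>

definition frac_rel ::
  "('a, 'b) ring_scheme \<Rightarrow> 'a \<Rightarrow> (('a \<times> nat) \<times> ('a \<times> nat)) set" where
  "frac_rel R x = {((a, m), (b, n)). a \<in> carrier R \<and> b \<in> carrier R \<and>
     (\<exists>k::nat. x [^]\<^bsub>R\<^esub> k \<otimes>\<^bsub>R\<^esub> (x [^]\<^bsub>R\<^esub> n \<otimes>\<^bsub>R\<^esub> a) =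
               x [^]\<^bsub>R\<^esub> k \<otimes>\<^bsub>R\<^esub> (x [^]\<^bsub>R\<^esub> m \<otimes>\<^bsub>R\<^esub> b))}"

definition loc_frac :: "('a, 'b) ring_scheme \<Rightarrow> 'a \<Rightarrow> 'a \<Rightarrow> nat \<Rightarrow> ('a \<times> nat) set" where
  "loc_frac R x a m = frac_rel R x `` {(a, m)}"

text \<open>Operations on classes are unions over all representatives; all members of such a
  union coincide, so that it is again a single class.\<close>

definition localization :: "('a, 'b) ring_scheme \<Rightarrow> 'a \<Rightarrow> ('a \<times> nat) set ring" where
  "localization R x =
     \<lparr>carrier = (carrier R \<times> UNIV) // frac_rel R x,
      monoid.mult = (\<lambda>U V. \<Union>(a, m)\<in>U. \<Union>(b, n)\<in>V. loc_frac R x (a \<otimes>\<^bsub>R\<^esub> b) (m + n)),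
      one = loc_frac R x \<one>\<^bsub>R\<^esub> 0,
      ring.zero = loc_frac R x \<zero>\<^bsub>R\<^esub> 0,
      ring.add = (\<lambda>U V. \<Union>(a, m)\<in>U. \<Union>(b, n)\<in>V.
        loc_frac R x ((x [^]\<^bsub>R\<^esub> n \<otimes>\<^bsub>R\<^esub> a) \<oplus>\<^bsub>R\<^esub> (x [^]\<^bsub>R\<^esub> m \<otimes>\<^bsub>R\<^esub> b)) (m + n))\<rparr>"


section \<open>The Cech complex\<close>

text \<open>For \<open>xs = [x\<^sub>0, \<dots>, x\<^sub>d\<^sub>-\<^sub>1]\<close> the group in degree \<open>i\<close> is the direct sum, over the
  \<open>i\<close>-element sets \<open>S\<close> of indices, of the localizations at \<open>x\<^sub>S = \<Prod>\<^sub>j\<^sub>\<in>\<^sub>S x\<^sub>j\<close>.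
  In degree \<open>0\<close> this is the localization of \<open>R\<close> at \<open>1\<close>, that is, \<open>R\<close> itself.\<close>

definition cech_index :: "'a list \<Rightarrow> nat \<Rightarrow> nat set set" where
  "cech_index xs i = {S. S \<subseteq> {..<length xs} \<and> card S = i}"

definition cech_loc :: "('a, 'b) ring_scheme \<Rightarrow> 'a list \<Rightarrow> nat set \<Rightarrow> ('a \<times> nat) set ring" where
  "cech_loc R xs S = localization R (finprod R (\<lambda>j. xs ! j) S)"

definition cech_group ::
  "('a, 'b) ring_scheme \<Rightarrow> 'a list \<Rightarrow> nat \<Rightarrow> (nat set \<Rightarrow> ('a \<times> nat) set) monoid" where
  "cech_group R xs i = product_group (cech_index xs i) (\<lambda>S. add_monoid (cech_loc R xs S))"

text \<open>For \<open>j \<in> T\<close>, the canonical map from the localization at \<open>x\<^sub>T\<^sub>-\<^sub>{\<^sub>j\<^sub>}\<close> to the one at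
  \<open>x\<^sub>T\<close>, rewriting the fraction \<open>a/y\<^sup>m\<close> as \<open>a x\<^sub>j\<^sup>m/(y x\<^sub>j)\<^sup>m\<close>.\<close>

definition cech_face ::
  "('a, 'b) ring_scheme \<Rightarrow> 'a list \<Rightarrow> nat \<Rightarrow> nat set \<Rightarrow> ('a \<times> nat) set \<Rightarrow> ('a \<times> nat) set" where
  "cech_face R xs j T U =
     (\<Union>(a, m)\<in>U. loc_frac R (finprod R (\<lambda>k. xs ! k) T) (a \<otimes>\<^bsub>R\<^esub> (xs ! j) [^]\<^bsub>R\<^esub> m) m)"

definition cech_diff ::
  "('a, 'b) ring_scheme \<Rightarrow> 'a list \<Rightarrow> nat \<Rightarrow>
     (nat set \<Rightarrow> ('a \<times> nat) set) \<Rightarrow> (nat set \<Rightarrow> ('a \<times> nat) set)" where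
  "cech_diff R xs i c = (\<lambda>T \<in> cech_index xs (Suc i).
     finsum (cech_loc R xs T)
       (\<lambda>j. if even (card {k \<in> T. k < j})
            then cech_face R xs j T (c (T - {j}))
            else \<ominus>\<^bsub>cech_loc R xs T\<^esub> cech_face R xs j T (c (T - {j}))) T)"

definition cech_cocycles ::
  "('a, 'b) ring_scheme \<Rightarrow> 'a list \<Rightarrow> nat \<Rightarrow> (nat set \<Rightarrow> ('a \<times> nat) set) set" where
  "cech_cocycles R xs i =
     kernel (cech_group R xs i) (cech_group R xs (Suc i)) (cech_diff R xs i)"

definition cech_coboundaries ::
  "('a, 'b) ring_scheme \<Rightarrow> 'a list \<Rightarrow> nat \<Rightarrow> (nat set \<Rightarrow> ('a \<times> nat) set) set" where
  "cech_coboundaries R xs i =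
     (case i of 0 \<Rightarrow> {\<one>\<^bsub>cech_group R xs 0\<^esub>}
      | Suc h \<Rightarrow> cech_diff R xs h ` carrier (cech_group R xs h))"

definition cech_cohomology ::
  "('a, 'b) ring_scheme \<Rightarrow> 'a list \<Rightarrow> nat \<Rightarrow> (nat set \<Rightarrow> ('a \<times> nat) set) set monoid" where
  "cech_cohomology R xs i =
     (cech_group R xs i)\<lparr>carrier := cech_cocycles R xs i\<rparr> Mod cech_coboundaries R xs i"


section \<open>Frobenius action and F-injectivity\<close>

definition cech_frobenius ::
  "('a, 'b) ring_scheme \<Rightarrow> nat \<Rightarrow> 'a list \<Rightarrow> nat \<Rightarrow>
     (nat set \<Rightarrow> ('a \<times> nat) set) \<Rightarrow> (nat set \<Rightarrow> ('a \<times> nat) set)" where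
  "cech_frobenius R p xs i c =
     (\<lambda>S \<in> cech_index xs i. c S [^]\<^bsub>cech_loc R xs S\<^esub> p)"

text \<open>The induced map on cosets: the coset of \<open>c\<close> goes to the coset of the Frobenius
  image of \<open>c\<close>, again written as a union over representatives.\<close>

definition cohomology_frobenius ::
  "('a, 'b) ring_scheme \<Rightarrow> nat \<Rightarrow> 'a list \<Rightarrow> nat \<Rightarrow>
     (nat set \<Rightarrow> ('a \<times> nat) set) set \<Rightarrow> (nat set \<Rightarrow> ('a \<times> nat) set) set" where
  "cohomology_frobenius R p xs i U =
     (\<Union>c\<in>U. cech_coboundaries R xs i #>\<^bsub>cech_group R xs i\<^esub> cech_frobenius R p xs i c)"

text \<open>The local cohomology of \<open>R\<close> at \<open>\<mm>\<close>, with its Frobenius action, is the Cech cohomology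
  of a system of parameters. Up to isomorphism compatible with the Frobenius maps it does not
  depend on the system, and every Noetherian local ring has one, so quantifying existentially
  or universally over the systems of parameters gives the same notion.\<close>

definition F_injective :: "('a, 'b) ring_scheme \<Rightarrow> 'a set \<Rightarrow> nat \<Rightarrow> bool" where
  "F_injective R \<mm> p \<longleftrightarrow>
     (\<exists>xs. system_of_parameters R \<mm> xs \<and>
       (\<forall>i. inj_on (cohomology_frobenius R p xs i) (carrier (cech_cohomology R xs i))))"

end

theory Submission
  imports Defs
begin

text \<open>
  Let \<open>x\<close> be a parameter. Injectivity of Frobenius on \<open>R\<^sub>x/R\<close>, the top local cohomology,
  means that an element of \<open>R\<^sub>x\<close> lies in \<open>R\<close> as soon as its \<open>p\<close>-th power does. Let \<open>T = \<mm> : \<mm>\<close>,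
  taken inside \<open>R\<^sub>x\<close>; then \<open>T = R\<close>. Indeed an element \<open>f\<close> of \<open>T\<close> is integral over \<open>R\<close>, and a root in the
  residue field of a polynomial of minimal degree killing \<open>f\<close> modulo \<open>\<mm>\<close> provides \<open>c \<in> R\<close> such that
  \<open>t = f - c\<close> is no unit in \<open>T/\<mm>\<close>. Since \<open>R\<close> is complete and \<open>T\<close> is a domain, \<open>T/\<mm>\<close> has no
  nontrivial idempotents, which forces \<open>t\<close> to be nilpotent modulo \<open>\<mm>\<close>; so some \<open>t^(p^j)\<close> lies in
  \<open>\<mm> \<subseteq> R\<close>, whence \<open>t \<in> R\<close>.

  If \<open>\<mm> \<noteq> (x)\<close>, choose \<open>b \<notin> (x)\<close> with \<open>b \<mm> \<subseteq> (x)\<close>. As \<open>b/x \<notin> R = T\<close>, the ideal \<open>(b/x) \<mm>\<close>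
  of \<open>R\<close> is not contained in \<open>\<mm>\<close>, hence it is \<open>R\<close>, and \<open>\<mm>\<close> is generated by \<open>x/b\<close>.
\<close>

section \<open>The Frobenius endomorphism\<close>

lemma (in cring) binomial:
  assumes [simp]: "a \<in> carrier R" "b \<in> carrier R"
  shows "(a \<oplus> b) [^] n =
    (\<Oplus>k\<in>{..n}. add_pow R (n choose k) (a [^] k \<otimes> b [^] (n - k)))"
proof (induction n)
  case 0
  show ?case by (simp add: add.nat_pow_eone)
next
  case (Suc n)
  let ?t = "\<lambda>c k. add_pow R (c choose k) (a [^] k \<otimes> b [^] (n - k))"
  let ?S = "\<Oplus>k\<in>{..n}. ?t n k"
  \<comment> \<open>\<open>?f\<close> and \<open>?g\<close> are the terms of \<open>?S\<close> times
    \<open>a\<close> and of \<open>?S\<close> times \<open>b\<close>. Pascal's rule merges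
    \<open>?f k\<close> with \<open>?g (Suc k)\<close>.\<close>
  let ?f = "\<lambda>k. add_pow R (n choose k) (a [^] Suc k \<otimes> b [^] (n - k))"
  let ?g = "\<lambda>k. add_pow R (n choose k) (a [^] k \<otimes> b [^] (Suc n - k))"
  have 1: "?S \<otimes> a = (\<Oplus>k\<in>{..n}. ?f k)"
    by (simp add: finsum_ldistr add_pow_ldistr, rule finsum_cong') (auto simp: m_ac)
  have "?S \<otimes> b = (\<Oplus>k\<in>{..n}. ?g k)"
    by (simp add: finsum_ldistr add_pow_ldistr, rule finsum_cong')
      (auto simp: m_ac Suc_diff_le)
  \<comment> \<open>The added top term has binomial coefficient zero; it allows the sum to be split
    at its bottom term and shifted.\<close>
  also have "\<dots> = (\<Oplus>k\<in>{..Suc n}. ?g k)"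
    by (subst finsum_Suc) (auto simp: binomial_eq_0)
  also have "\<dots> = (\<Oplus>k\<in>{..n}. ?g (Suc k)) \<oplus> ?g 0"
    by (subst finsum_Suc2) auto
  finally have 2: "?S \<otimes> b = (\<Oplus>k\<in>{..n}. ?g (Suc k)) \<oplus> b [^] Suc n"
    by (simp add: add.nat_pow_eone)
  have "(\<Oplus>k\<in>{..Suc n}. add_pow R (Suc n choose k) (a [^] k \<otimes> b [^] (Suc n - k))) =
    (\<Oplus>k\<in>{..n}. ?f k \<oplus> ?g (Suc k)) \<oplus> b [^] Suc n"
    by (subst finsum_Suc2) (auto simp: add.nat_pow_mult add.nat_pow_eone)
  also have "\<dots> = (\<Oplus>k\<in>{..n}. ?f k) \<oplus> (\<Oplus>k\<in>{..n}. ?g (Suc k)) \<oplus> b [^] Suc n"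
    by (subst finsum_addf) auto
  also have "\<dots> = ?S \<otimes> a \<oplus> ?S \<otimes> b"
    by (simp only: 1 2) (simp add: a_assoc)
  finally show ?case
    by (simp add: Suc r_distr)
qed

lemma (in cring) add_pow_char:
  assumes "add_pow R p \<one> = \<zero>" "p dvd k" "a \<in> carrier R"
  shows "add_pow R (k::nat) a = \<zero>"
proof -
  obtain q where "k = p * q" using assms(2) by auto
  then have "add_pow R k a = add_pow R q (add_pow R p \<one> \<otimes> a)"
    using assms(3) by (simp add: add_pow_ldistr add.nat_pow_pow mult.commute)
  then show ?thesis using assms(1,3) by simp
qed

text \<open>All binomial coefficients strictly between the ends are divisible by \<open>p\<close>,
  so only the two extreme terms survive.\<close>

lemma (in cring) frobenius_add:
  assumes "Factorial_Ring.prime p" and ch: "add_pow R p \<one> = \<zero>"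
    and [simp]: "a \<in> carrier R" "b \<in> carrier R"
  shows "(a \<oplus> b) [^] p = a [^] p \<oplus> b [^] (p::nat)"
proof -
  \<comment> \<open>In this form both end terms can be split off, and the inner indices are exactly
    \<open>Suc k\<close> with \<open>k \<le> r\<close>.\<close>
  obtain r where p: "p = Suc (Suc r)"
    using prime_ge_2_nat[OF assms(1)] by (metis Suc_le_D numeral_2_eq_2 Suc_le_mono)
  let ?t = "\<lambda>k. add_pow R (p choose k) (a [^] k \<otimes> b [^] (p - k))"
  have "?t (Suc k) = \<zero>" if "k \<le> r" for k
    by (rule add_pow_char[OF ch dvd_choose_prime]) (use that p assms(1) in auto)
  then have mid: "(\<Oplus>k\<in>{..r}. ?t (Suc k)) = \<zero>"
    by (intro add.finprod_one_eqI) auto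
  have "(a \<oplus> b) [^] p = (\<Oplus>k\<in>{..Suc (Suc r)}. ?t k)"
    using binomial[of a b p] p by simp
  also have "\<dots> = ?t p \<oplus> ((\<Oplus>k\<in>{..r}. ?t (Suc k)) \<oplus> ?t 0)"
    by (subst finsum_Suc, simp, subst finsum_Suc2) (auto simp: p)
  also have "\<dots> = a [^] p \<oplus> b [^] p"
    by (subst mid) (simp add: add.nat_pow_eone)
  finally show ?thesis .
qed

lemma (in cring) frobenius_add_power:
  assumes "Factorial_Ring.prime p" and "add_pow R p \<one> = \<zero>"
    and "a \<in> carrier R" "b \<in> carrier R"
  shows "(a \<oplus> b) [^] (p ^ n) = a [^] (p ^ n) \<oplus> b [^] (p ^ n :: nat)"
  using assms(3,4)
proof (induction n)
  case (Suc n)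
  then show ?case
    using frobenius_add[OF assms(1,2)] by (simp add: nat_pow_pow[symmetric] mult.commute[of p])
qed simp

text \<open>Additivity is applied to the sum of \<open>a \<ominus> b\<close> and \<open>b\<close>,
  which avoids discussing the sign of a power of -1.\<close>

lemma (in cring) frobenius_minus:
  assumes "Factorial_Ring.prime p" and "add_pow R p \<one> = \<zero>"
    and [simp]: "a \<in> carrier R" "b \<in> carrier R"
  shows "(a \<ominus> b) [^] (p ^ n) = a [^] (p ^ n) \<ominus> b [^] (p ^ n :: nat)"
proof -
  have "a \<ominus> b \<oplus> b = a" by (simp add: minus_eq a_assoc l_neg)
  then have "a [^] (p ^ n) = (a \<ominus> b) [^] (p ^ n) \<oplus> b [^] (p ^ n)"
    using frobenius_add_power[OF assms(1,2), of "a \<ominus> b" b n] by simp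
  then show ?thesis
    by (simp add: minus_eq a_assoc r_neg)
qed

section \<open>Localization of a domain at an element\<close>

locale domain_localization = domain R for R (structure) +
  fixes x
  assumes x_carrier [simp]: "x \<in> carrier R" and x_nonzero: "x \<noteq> \<zero>"
begin

abbreviation "L \<equiv> localization R x"

lemma pow_nonzero [simp]: "x [^] (k::nat) \<noteq> \<zero>"
  by (induction k) (auto simp: integral_iff x_nonzero)

lemma pow_cancel:
  assumes "a \<in> carrier R" "b \<in> carrier R"
  shows "x [^] (k::nat) \<otimes> a = x [^] k \<otimes> b \<longleftrightarrow> a = b"
  by (rule m_lcancel) (use assms x_nonzero in auto)

text \<open>Powers of a nonzero element of a domain cancel, so the auxiliary factor
  \<open>x [^] k\<close> of the general definition disappears.\<close>

lemma frac_rel_iff: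
  "((a, m), (b, n)) \<in> frac_rel R x \<longleftrightarrow>
    a \<in> carrier R \<and> b \<in> carrier R \<and> x [^] n \<otimes> a = x [^] m \<otimes> b"
  unfolding frac_rel_def by (auto simp: pow_cancel)

lemma frac_rel_trans:
  assumes "a \<in> carrier R" "b \<in> carrier R" "c \<in> carrier R"
    and "x [^] n \<otimes> a = x [^] m \<otimes> b" "x [^] k \<otimes> b = x [^] (n::nat) \<otimes> c"
  shows "x [^] (k::nat) \<otimes> a = x [^] (m::nat) \<otimes> c"
proof -
  have "x [^] n \<otimes> (x [^] k \<otimes> a) = x [^] k \<otimes> (x [^] n \<otimes> a)"
    using assms(1-3) by (intro m_lcomm) auto
  also have "\<dots> = x [^] m \<otimes> (x [^] k \<otimes> b)"
    using assms(1-3) by (simp add: assms(4) m_lcomm)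
  also have "\<dots> = x [^] n \<otimes> (x [^] m \<otimes> c)"
    using assms(1-3) by (simp add: assms(5) m_lcomm)
  finally show ?thesis using assms(1-3) by (simp add: pow_cancel)
qed

lemma equiv_frac_rel: "equiv (carrier R \<times> UNIV) (frac_rel R x)"
proof (rule equivI)
  show "refl_on (carrier R \<times> UNIV) (frac_rel R x)"
    by (auto simp: refl_on_def frac_rel_iff)
  show "sym (frac_rel R x)"
    by (auto simp: sym_def frac_rel_iff)
  show "trans (frac_rel R x)"
    by (rule transI) (auto simp: frac_rel_iff intro: frac_rel_trans)
qed (auto simp: frac_rel_def)

lemma loc_frac_eq_iff:
  assumes "a \<in> carrier R" "b \<in> carrier R"
  shows "loc_frac R x a m = loc_frac R x b n \<longleftrightarrow> x [^] n \<otimes> a = x [^] m \<otimes> b"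
  unfolding loc_frac_def
  using eq_equiv_class_iff[OF equiv_frac_rel, of "(a, m)" "(b, n)"] assms
  by (auto simp: frac_rel_iff)

lemma mem_loc_frac:
  "(b, n) \<in> loc_frac R x a m \<longleftrightarrow> a \<in> carrier R \<and> b \<in> carrier R \<and> x [^] n \<otimes> a = x [^] m \<otimes> b"
  by (simp add: loc_frac_def frac_rel_iff)

lemma carrier_localization: "carrier L = {loc_frac R x a m |a m. a \<in> carrier R}"
  by (auto simp: localization_def quotient_def loc_frac_def)

lemma loc_frac_closed [simp]: "a \<in> carrier R \<Longrightarrow> loc_frac R x a m \<in> carrier L"
  by (auto simp: carrier_localization)

lemma localization_cases:
  assumes "u \<in> carrier L"
  obtains a m where "a \<in> carrier R" "u = loc_frac R x a m"
  using assms by (auto simp: carrier_localization)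

text \<open>Well-definedness in the form needed for operations written as unions over
  representatives: if all members of the union agree, it is any one of them.\<close>

lemma UN_loc_frac:
  assumes "a \<in> carrier R"
    and "\<And>b n. b \<in> carrier R \<Longrightarrow> x [^] n \<otimes> a = x [^] m \<otimes> b \<Longrightarrow> F b n = F a m"
  shows "(\<Union>(b, n)\<in>loc_frac R x a m. F b n) = F a m"
proof -
  have "(a, m) \<in> loc_frac R x a m" using assms(1) by (simp add: mem_loc_frac)
  then have ne: "loc_frac R x a m \<noteq> {}" by blast
  have "(\<Union>(b, n)\<in>loc_frac R x a m. F b n) = (\<Union>p\<in>loc_frac R x a m. F a m)"
  proof (rule SUP_cong)
    fix p assume "p \<in> loc_frac R x a m"
    then show "(case p of (b, n) \<Rightarrow> F b n) = F a m"
      using assms(2)[of "fst p" "snd p"] mem_loc_frac[of "fst p" "snd p" a m]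
      by (simp add: case_prod_beta)
  qed simp
  also have "\<dots> = F a m" using ne by simp
  finally show ?thesis .
qed

lemma mult_loc_frac:
  assumes [simp]: "a \<in> carrier R" "b \<in> carrier R"
  shows "loc_frac R x a m \<otimes>\<^bsub>L\<^esub> loc_frac R x b n = loc_frac R x (a \<otimes> b) (m + n)"
    (is "?lhs = _")
proof -
  \<comment> \<open>The union over the second factor collapses first, for every fixed representative
    of the first factor; \<open>outer\<close> then handles the first factor.\<close>
  have inner: "(\<Union>(b', n')\<in>loc_frac R x b n. loc_frac R x (c \<otimes> b') (k + n')) =
    loc_frac R x (c \<otimes> b) (k + n)" if [simp]: "c \<in> carrier R" for c and k :: nat
  proof (rule UN_loc_frac)
    fix b' and n' :: nat assume [simp]: "b' \<in> carrier R" and e: "x [^] n' \<otimes> b = x [^] n \<otimes> b'"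
    have "x [^] (k + n) \<otimes> (c \<otimes> b') = x [^] k \<otimes> c \<otimes> (x [^] n \<otimes> b')"
      by (simp add: nat_pow_mult[symmetric] m_ac)
    also have "\<dots> = x [^] (k + n') \<otimes> (c \<otimes> b)"
      unfolding e[symmetric] by (simp add: nat_pow_mult[symmetric] m_ac)
    finally show "loc_frac R x (c \<otimes> b') (k + n') = loc_frac R x (c \<otimes> b) (k + n)"
      by (simp add: loc_frac_eq_iff)
  qed simp
  have outer: "(\<Union>(a', m')\<in>loc_frac R x a m. loc_frac R x (a' \<otimes> b) (m' + n)) =
    loc_frac R x (a \<otimes> b) (m + n)"
  proof (rule UN_loc_frac)
    fix a' and m' :: nat assume [simp]: "a' \<in> carrier R" and e: "x [^] m' \<otimes> a = x [^] m \<otimes> a'"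
    have "x [^] (m + n) \<otimes> (a' \<otimes> b) = x [^] n \<otimes> b \<otimes> (x [^] m \<otimes> a')"
      by (simp add: nat_pow_mult[symmetric] m_ac)
    also have "\<dots> = x [^] (m' + n) \<otimes> (a \<otimes> b)"
      unfolding e[symmetric] by (simp add: nat_pow_mult[symmetric] m_ac)
    finally show "loc_frac R x (a' \<otimes> b) (m' + n) = loc_frac R x (a \<otimes> b) (m + n)"
      by (simp add: loc_frac_eq_iff)
  qed simp
  have "?lhs = (\<Union>(a', m')\<in>loc_frac R x a m. \<Union>(b', n')\<in>loc_frac R x b n. loc_frac R x (a' \<otimes> b') (m' + n'))"
    by (simp add: localization_def)
  also have "\<dots> = (\<Union>(a', m')\<in>loc_frac R x a m. loc_frac R x (a' \<otimes> b) (m' + n))"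
    by (rule SUP_cong) (simp_all add: split_paired_all mem_loc_frac inner)
  finally show ?thesis unfolding outer .
qed

lemma add_loc_frac:
  assumes [simp]: "a \<in> carrier R" "b \<in> carrier R"
  shows "loc_frac R x a m \<oplus>\<^bsub>L\<^esub> loc_frac R x b n =
    loc_frac R x (x [^] n \<otimes> a \<oplus> x [^] m \<otimes> b) (m + n)"
    (is "?lhs = _")
proof -
  have inner: "(\<Union>(b', n')\<in>loc_frac R x b n. loc_frac R x (x [^] n' \<otimes> c \<oplus> x [^] k \<otimes> b') (k + n')) =
    loc_frac R x (x [^] n \<otimes> c \<oplus> x [^] k \<otimes> b) (k + n)" if [simp]: "c \<in> carrier R" for c and k :: nat
  proof (rule UN_loc_frac)
    fix b' and n' :: nat assume [simp]: "b' \<in> carrier R" and e: "x [^] n' \<otimes> b = x [^] n \<otimes> b'"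
    have "x [^] (k + n) \<otimes> (x [^] n' \<otimes> c \<oplus> x [^] k \<otimes> b') =
      x [^] (k + n + n') \<otimes> c \<oplus> x [^] (k + k) \<otimes> (x [^] n \<otimes> b')"
      by (simp add: nat_pow_mult[symmetric] m_ac r_distr)
    also have "\<dots> = x [^] (k + n') \<otimes> (x [^] n \<otimes> c \<oplus> x [^] k \<otimes> b)"
      unfolding e[symmetric] by (simp add: nat_pow_mult[symmetric] m_ac r_distr)
    finally show "loc_frac R x (x [^] n' \<otimes> c \<oplus> x [^] k \<otimes> b') (k + n') =
      loc_frac R x (x [^] n \<otimes> c \<oplus> x [^] k \<otimes> b) (k + n)"
      by (simp add: loc_frac_eq_iff)
  qed simp
  have outer: "(\<Union>(a', m')\<in>loc_frac R x a m. loc_frac R x (x [^] n \<otimes> a' \<oplus> x [^] m' \<otimes> b) (m' + n)) =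
    loc_frac R x (x [^] n \<otimes> a \<oplus> x [^] m \<otimes> b) (m + n)"
  proof (rule UN_loc_frac)
    fix a' and m' :: nat assume [simp]: "a' \<in> carrier R" and e: "x [^] m' \<otimes> a = x [^] m \<otimes> a'"
    have "x [^] (m + n) \<otimes> (x [^] n \<otimes> a' \<oplus> x [^] m' \<otimes> b) =
      x [^] (m + n + m') \<otimes> b \<oplus> x [^] (n + n) \<otimes> (x [^] m \<otimes> a')"
      by (simp add: nat_pow_mult[symmetric] m_ac r_distr a_comm)
    also have "\<dots> = x [^] (m' + n) \<otimes> (x [^] n \<otimes> a \<oplus> x [^] m \<otimes> b)"
      unfolding e[symmetric] by (simp add: nat_pow_mult[symmetric] m_ac r_distr a_comm)
    finally show "loc_frac R x (x [^] n \<otimes> a' \<oplus> x [^] m' \<otimes> b) (m' + n) =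
      loc_frac R x (x [^] n \<otimes> a \<oplus> x [^] m \<otimes> b) (m + n)"
      by (simp add: loc_frac_eq_iff)
  qed simp
  have "?lhs = (\<Union>(a', m')\<in>loc_frac R x a m. \<Union>(b', n')\<in>loc_frac R x b n. loc_frac R x (x [^] n' \<otimes> a' \<oplus> x [^] m' \<otimes> b') (m' + n'))"
    by (simp add: localization_def)
  also have "\<dots> = (\<Union>(a', m')\<in>loc_frac R x a m. loc_frac R x (x [^] n \<otimes> a' \<oplus> x [^] m' \<otimes> b) (m' + n))"
    by (rule SUP_cong) (simp_all add: split_paired_all mem_loc_frac inner)
  finally show ?thesis unfolding outer .
qed

lemma one_localization: "\<one>\<^bsub>L\<^esub> = loc_frac R x \<one> 0"
  by (simp add: localization_def)

lemma zero_localization: "\<zero>\<^bsub>L\<^esub> = loc_frac R x \<zero> 0"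
  by (simp add: localization_def)

lemmas loc_frac_simps =
  mult_loc_frac add_loc_frac one_localization zero_localization loc_frac_eq_iff

lemma cring_localization: "cring L"
proof (rule cringI)
  show "abelian_group L"
  proof (rule abelian_groupI)
    fix u assume "u \<in> carrier L"
    then obtain a m where [simp]: "a \<in> carrier R" and u: "u = loc_frac R x a m"
      by (rule localization_cases)
    have "loc_frac R x (\<ominus> a) m \<oplus>\<^bsub>L\<^esub> u = \<zero>\<^bsub>L\<^esub>"
      unfolding u by (simp add: loc_frac_simps r_minus l_neg)
    then show "\<exists>v\<in>carrier L. v \<oplus>\<^bsub>L\<^esub> u = \<zero>\<^bsub>L\<^esub>" by force
  next
    fix u v assume uvw: "u \<in> carrier L" "v \<in> carrier L"
    obtain a i where [simp]: "a \<in> carrier R" and u: "u = loc_frac R x a i"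
      using uvw(1) by (rule localization_cases)
    obtain b j where [simp]: "b \<in> carrier R" and v: "v = loc_frac R x b j"
      using uvw(2) by (rule localization_cases)
    show "u \<oplus>\<^bsub>L\<^esub> v \<in> carrier L" "u \<oplus>\<^bsub>L\<^esub> v = v \<oplus>\<^bsub>L\<^esub> u"
      by (simp_all add: u v add_loc_frac a_comm add.commute)
  next
    fix u v w assume uvw: "u \<in> carrier L" "v \<in> carrier L" "w \<in> carrier L"
    obtain a i where [simp]: "a \<in> carrier R" and u: "u = loc_frac R x a i"
      using uvw(1) by (rule localization_cases)
    obtain b j where [simp]: "b \<in> carrier R" and v: "v = loc_frac R x b j"
      using uvw(2) by (rule localization_cases)
    obtain c k where [simp]: "c \<in> carrier R" and w: "w = loc_frac R x c k"
      using uvw(3) by (rule localization_cases)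
    show "u \<oplus>\<^bsub>L\<^esub> v \<oplus>\<^bsub>L\<^esub> w = u \<oplus>\<^bsub>L\<^esub> (v \<oplus>\<^bsub>L\<^esub> w)"
      by (simp add: u v w add_loc_frac nat_pow_mult[symmetric] r_distr m_ac a_assoc add.assoc)
  next
    fix u assume uvw: "u \<in> carrier L"
    obtain a i where [simp]: "a \<in> carrier R" and u: "u = loc_frac R x a i"
      using uvw by (rule localization_cases)
    then show "\<zero>\<^bsub>L\<^esub> \<oplus>\<^bsub>L\<^esub> u = u"
      by (simp add: zero_localization add_loc_frac)
  qed (simp add: zero_localization)
  show "Group.comm_monoid L"
    by (rule comm_monoidI)
      (auto elim!: localization_cases simp: mult_loc_frac one_localization m_ac add_ac)
next
  fix u v w assume uvw: "u \<in> carrier L" "v \<in> carrier L" "w \<in> carrier L"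
  obtain a i where [simp]: "a \<in> carrier R" and u: "u = loc_frac R x a i"
    using uvw(1) by (rule localization_cases)
  obtain b j where [simp]: "b \<in> carrier R" and v: "v = loc_frac R x b j"
    using uvw(2) by (rule localization_cases)
  obtain c k where [simp]: "c \<in> carrier R" and w: "w = loc_frac R x c k"
    using uvw(3) by (rule localization_cases)
  show "(u \<oplus>\<^bsub>L\<^esub> v) \<otimes>\<^bsub>L\<^esub> w = u \<otimes>\<^bsub>L\<^esub> w \<oplus>\<^bsub>L\<^esub> v \<otimes>\<^bsub>L\<^esub> w"
    by (simp add: u v w loc_frac_simps nat_pow_mult[symmetric] l_distr r_distr m_ac)
qed

sublocale L: cring L by (rule cring_localization)

lemma domain_localization: "domain L"
proof (rule domain.intro[OF cring_localization domain_axioms.intro])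
  show "\<one>\<^bsub>L\<^esub> \<noteq> \<zero>\<^bsub>L\<^esub>" by (simp add: loc_frac_simps)
next
  fix u v assume uv: "u \<otimes>\<^bsub>L\<^esub> v = \<zero>\<^bsub>L\<^esub>" "u \<in> carrier L" "v \<in> carrier L"
  obtain a m where [simp]: "a \<in> carrier R" and u: "u = loc_frac R x a m"
    using uv(2) by (rule localization_cases)
  obtain b n where [simp]: "b \<in> carrier R" and v: "v = loc_frac R x b n"
    using uv(3) by (rule localization_cases)
  show "u = \<zero>\<^bsub>L\<^esub> \<or> v = \<zero>\<^bsub>L\<^esub>"
    using uv(1) by (simp add: u v loc_frac_simps integral_iff)
qed

definition of_base where "of_base a = loc_frac R x a 0"

lemma ring_hom_of_base: "ring_hom_cring R L of_base"
  by (rule ring_hom_cringI[OF is_cring cring_localization]) (auto simp: ring_hom_def of_base_def loc_frac_simps)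

lemma inj_of_base: "inj_on of_base (carrier R)"
  by (auto simp: inj_on_def of_base_def loc_frac_simps)

end

section \<open>Frobenius on the top Cech cohomology of one element\<close>

text \<open>For one parameter the Cech complex is R -> R_x -> 0, so degree 1 is the top
  degree.\<close>

lemma cech_index_singleton:
  "cech_index [x] 0 = {{}}" "cech_index [x] (Suc 0) = {{0}}" "cech_index [x] (Suc (Suc 0)) = {}"
proof -
  have sub: "S \<subseteq> {..<length [x]} \<longleftrightarrow> S = {} \<or> S = {0::nat}" for S
    by (auto simp: lessThan_Suc)
  show "cech_index [x] 0 = {{}}" "cech_index [x] (Suc 0) = {{0}}" "cech_index [x] (Suc (Suc 0)) = {}"
    unfolding cech_index_def sub by auto
qed

context domain_localization
begin

lemma cech_loc_singleton: "cech_loc R [x] {0} = L" "cech_loc R [x] {} = localization R \<one>"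
proof -
  have "finprod R ((!) [x]) {0} = x"
    by (subst finprod_insert) auto
  then show "cech_loc R [x] {0} = L" "cech_loc R [x] {} = localization R \<one>"
    by (simp_all add: cech_loc_def)
qed

text \<open>Elements of a product group are extensional functions; this is the one with value
  \<open>u\<close> at the only index of degree 1, which identifies \<open>L\<close> with the group
  \<open>C1\<close>.\<close>

abbreviation cochain :: "('a \<times> nat) set \<Rightarrow> nat set \<Rightarrow> ('a \<times> nat) set" where
  "cochain u \<equiv> (\<lambda>S\<in>{{0}}. u)"

abbreviation "C1 \<equiv> cech_group R [x] (Suc 0)"

lemma cochain_eq_iff: "cochain u = cochain v \<longleftrightarrow> u = v"
  by (metis insertI1 restrict_apply')

lemma carrier_C1: "carrier C1 = cochain ` carrier L"
proof -
  have "carrier C1 = (\<Pi>\<^sub>E S\<in>{{0}}. carrier L)"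
    unfolding cech_group_def carrier_product_group cech_index_singleton
    by (rule PiE_cong) (simp add: cech_loc_singleton)
  also have "\<dots> = cochain ` carrier L"
    by (auto simp: PiE_singleton image_def fun_eq_iff PiE_iff extensional_def)
  finally show ?thesis .
qed

lemma mult_C1: "cochain u \<otimes>\<^bsub>C1\<^esub> cochain v = cochain (u \<oplus>\<^bsub>L\<^esub> v)"
  by (auto simp: cech_group_def cech_index_singleton cech_loc_singleton restrict_def fun_eq_iff)

text \<open>The group in degree 2 is a product over no indices, hence trivial, and every cochain is
  a cocycle.\<close>

lemma cech_cocycles_top: "cech_cocycles R [x] (Suc 0) = carrier C1"
  by (auto simp: cech_cocycles_def kernel_def cech_group_def cech_diff_def cech_index_singleton)

text \<open>Degree 0 is the localization at 1, where a/1^m = a; the face map sends it to (a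
  x^m)/x^m, which is again a.\<close>

lemma cech_face_top:
  assumes [simp]: "a \<in> carrier R"
  shows "cech_face R [x] 0 {0} (loc_frac R \<one> a m) = of_base a"
proof -
  interpret one: domain_localization R \<one> by unfold_locales auto
  have "finprod R ((!) [x]) {0} = x"
    by (subst finprod_insert) auto
  then have "cech_face R [x] 0 {0} (loc_frac R \<one> a m) =
    (\<Union>(b, n)\<in>loc_frac R \<one> a m. loc_frac R x (b \<otimes> x [^] n) n)"
    by (simp add: cech_face_def)
  also have "\<dots> = loc_frac R x (a \<otimes> x [^] m) m"
    by (rule one.UN_loc_frac) (simp_all add: loc_frac_eq_iff m_ac)
  also have "\<dots> = of_base a"
    by (simp add: of_base_def loc_frac_eq_iff m_comm)
  finally show ?thesis .
qed

lemma of_base_closed [simp]: "a \<in> carrier R \<Longrightarrow> of_base a \<in> carrier L"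
  by (simp add: of_base_def)

text \<open>Together with \<open>cech_cocycles_top\<close> this identifies the top cohomology with
  R_x/R.\<close>

lemma cech_coboundaries_top:
  "cech_coboundaries R [x] (Suc 0) = cochain ` of_base ` carrier R"
proof -
  interpret one: domain_localization R \<one> by unfold_locales auto
  have diff: "cech_diff R [x] 0 c = cochain (of_base a)"
    if "a \<in> carrier R" "c {} = loc_frac R \<one> a m" for c a m
  proof -
    \<comment> \<open>No index lies below 0, so the single summand carries the sign plus.\<close>
    have fin: "finsum L (\<lambda>j. if even (card {k \<in> {0}. k < j}) then cech_face R [x] j {0} (c ({0} - {j}))
        else \<ominus>\<^bsub>L\<^esub> cech_face R [x] j {0} (c ({0} - {j}))) {0} = of_base a"
      by (subst L.finsum_insert) (use that in \<open>auto simp: cech_face_top\<close>)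
    show ?thesis
      unfolding cech_diff_def cech_index_singleton
      by (rule restrict_ext) (drule singletonD, hypsubst, simp only: cech_loc_singleton fin)
  qed
  have C0: "carrier (cech_group R [x] 0) = (\<Pi>\<^sub>E S\<in>{{}}. carrier (localization R \<one>))"
    unfolding cech_group_def carrier_product_group cech_index_singleton
    by (rule PiE_cong) (simp add: cech_loc_singleton)
  have "cech_diff R [x] 0 ` carrier (cech_group R [x] 0) = cochain ` of_base ` carrier R"
  proof (intro equalityI subsetI)
    fix d assume "d \<in> cech_diff R [x] 0 ` carrier (cech_group R [x] 0)"
    then obtain c where c: "c \<in> carrier (cech_group R [x] 0)" "d = cech_diff R [x] 0 c"
      by blast
    then have "c {} \<in> carrier (localization R \<one>)" by (auto simp: C0)
    then obtain a m where "a \<in> carrier R" "c {} = loc_frac R \<one> a m"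
      by (rule one.localization_cases)
    then show "d \<in> cochain ` of_base ` carrier R" using diff c(2) by blast
  next
    fix d assume "d \<in> cochain ` of_base ` carrier R"
    then obtain a where a: "a \<in> carrier R" "d = cochain (of_base a)" by blast
    let ?c = "\<lambda>S\<in>{{}}. loc_frac R \<one> a 0"
    have "?c \<in> carrier (cech_group R [x] 0)" using a(1) by (auto simp: C0)
    moreover have "cech_diff R [x] 0 ?c = d" using diff[OF a(1)] a(2) by simp
    ultimately show "d \<in> cech_diff R [x] 0 ` carrier (cech_group R [x] 0)" by blast
  qed
  then show ?thesis by (simp add: cech_coboundaries_def)
qed

lemma cech_frobenius_cochain:
  "cech_frobenius R p [x] (Suc 0) (cochain u) = cochain (u [^]\<^bsub>L\<^esub> p)"
  by (auto simp: cech_frobenius_def cech_index_singleton cech_loc_singleton restrict_def fun_eq_iff)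

lemma coset_cochain:
  "cech_coboundaries R [x] (Suc 0) #>\<^bsub>C1\<^esub> cochain u =
    {cochain (of_base a \<oplus>\<^bsub>L\<^esub> u) |a. a \<in> carrier R}"
  by (auto simp: r_coset_def cech_coboundaries_top mult_C1)

lemma carrier_cech_cohomology_top:
  "carrier (cech_cohomology R [x] (Suc 0)) =
    {cech_coboundaries R [x] (Suc 0) #>\<^bsub>C1\<^esub> cochain u |u. u \<in> carrier L}"
  by (auto simp: cech_cohomology_def FactGroup_def RCOSETS_def r_coset_def
      cech_cocycles_top carrier_C1)

interpretation h: ring_hom_cring R L of_base by (rule ring_hom_of_base)

lemma coset_cochain_base:
  assumes "v \<in> of_base ` carrier R"
  shows "cech_coboundaries R [x] (Suc 0) #>\<^bsub>C1\<^esub> cochain v = cech_coboundaries R [x] (Suc 0)"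
proof -
  obtain r where [simp]: "r \<in> carrier R" and v: "v = of_base r" using assms by blast
  have "cochain (of_base a) \<in> {cochain (of_base a \<oplus>\<^bsub>L\<^esub> v) |a. a \<in> carrier R}"
    if [simp]: "a \<in> carrier R" for a
  proof -
    have "a = (a \<ominus> r) \<oplus> r" by (simp add: minus_eq a_assoc l_neg)
    then have "of_base a = of_base (a \<ominus> r) \<oplus>\<^bsub>L\<^esub> v" unfolding v by (metis h.hom_add minus_closed \<open>r \<in> carrier R\<close> that)
    then show ?thesis by (auto intro!: exI[of _ "a \<ominus> r"])
  qed
  moreover have "cochain (of_base a \<oplus>\<^bsub>L\<^esub> v) \<in> cochain ` of_base ` carrier R"
    if "a \<in> carrier R" for a
    unfolding v using that by (metis a_closed h.hom_add image_eqI \<open>r \<in> carrier R\<close>)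
  ultimately show ?thesis
    unfolding coset_cochain by (auto simp: cech_coboundaries_top)
qed

text \<open>If u^p lies in R, then Frobenius sends the class of \<open>u\<close> in R_x/R to the
  class of zero, which is also the image of the zero class; injectivity puts \<open>u\<close> in
  R.\<close>

lemma frobenius_closed_base:
  assumes inj: "inj_on (cohomology_frobenius R p [x] (Suc 0)) (carrier (cech_cohomology R [x] (Suc 0)))"
    and p: "Factorial_Ring.prime p" "add_pow L p \<one>\<^bsub>L\<^esub> = \<zero>\<^bsub>L\<^esub>"
    and u: "u \<in> carrier L" "u [^]\<^bsub>L\<^esub> p \<in> of_base ` carrier R"
  shows "u \<in> of_base ` carrier R"
proof -
  let ?B = "cech_coboundaries R [x] (Suc 0)"
  \<comment> \<open>The Frobenius image is a union over all representatives \<open>of_base a\<close>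
    plus \<open>v\<close>. By additivity of Frobenius each of them has its \<open>p\<close>-th power
    in R and so contributes the trivial coset.\<close>
  have frob: "cohomology_frobenius R p [x] (Suc 0) (?B #>\<^bsub>C1\<^esub> cochain v) = ?B"
    if v: "v \<in> carrier L" "v [^]\<^bsub>L\<^esub> p \<in> of_base ` carrier R" for v
  proof -
    have "?B #>\<^bsub>C1\<^esub> cech_frobenius R p [x] (Suc 0) (cochain (of_base a \<oplus>\<^bsub>L\<^esub> v)) = ?B"
      if a: "a \<in> carrier R" for a
    proof -
      obtain r where r: "r \<in> carrier R" "v [^]\<^bsub>L\<^esub> p = of_base r" using v(2) by blast
      have "(of_base a \<oplus>\<^bsub>L\<^esub> v) [^]\<^bsub>L\<^esub> p = of_base (a [^] p \<oplus> r)"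
        using L.frobenius_add[OF p] v(1) a r by simp
      then show ?thesis
        unfolding cech_frobenius_cochain using a r(1)
        by (intro coset_cochain_base) (metis a_closed image_eqI nat_pow_closed)
    qed
    \<comment> \<open>Over an empty class the union would be empty instead of
      \<open>?B\<close>.\<close>
    moreover have "?B #>\<^bsub>C1\<^esub> cochain v \<noteq> {}" unfolding coset_cochain by auto
    ultimately show ?thesis
      unfolding cohomology_frobenius_def coset_cochain by auto
  qed
  have z: "\<zero>\<^bsub>L\<^esub> [^]\<^bsub>L\<^esub> p \<in> of_base ` carrier R"
    using prime_gt_0_nat[OF p(1)] by (metis L.nat_pow_zero gr_implies_not0 h.hom_zero image_eqI zero_closed)
  have "?B #>\<^bsub>C1\<^esub> cochain u = ?B #>\<^bsub>C1\<^esub> cochain \<zero>\<^bsub>L\<^esub>"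
    by (rule inj_onD[OF inj]) (use frob u z in \<open>auto simp: carrier_cech_cohomology_top\<close>)
  moreover have "cochain u \<in> ?B #>\<^bsub>C1\<^esub> cochain u"
    unfolding coset_cochain using u(1) by (auto intro!: exI[of _ \<zero>])
  ultimately obtain a where "a \<in> carrier R" "cochain u = cochain (of_base a \<oplus>\<^bsub>L\<^esub> \<zero>\<^bsub>L\<^esub>)"
    unfolding coset_cochain by auto
  then show ?thesis by (simp add: cochain_eq_iff)
qed

end

section \<open>Polynomials, ideal powers and local rings\<close>

text \<open>Coefficient lists begin with the leading coefficient, so equal lengths are what aligns
  the degrees.\<close>

lemma (in cring) eval_map2_add:
  assumes "length p = length q" "set p \<subseteq> carrier R" "set q \<subseteq> carrier R" and t: "t \<in> carrier R"
  shows "eval (map2 (\<oplus>) p q) t = eval p t \<oplus> eval q t"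
  using assms(1-3)
proof (induction p q rule: list_induct2)
  case (Cons a p b q)
  have "eval p t \<in> carrier R" "eval q t \<in> carrier R" "t [^] length q \<in> carrier R"
    "a \<in> carrier R" "b \<in> carrier R"
    using Cons t by (auto intro: eval_in_carrier)
  then show ?case using Cons t by (simp add: l_distr a_ac)
qed simp

lemma (in cring) eval_map_mult:
  assumes "set p \<subseteq> carrier R" "t \<in> carrier R" "c \<in> carrier R"
  shows "eval (map ((\<otimes>) c) p) t = c \<otimes> eval p t"
  using assms(1)
proof (induction p)
  case (Cons a p)
  have "eval p t \<in> carrier R" "a \<in> carrier R"
    using Cons assms by (auto intro: eval_in_carrier)
  then show ?case using Cons assms by (simp add: r_distr m_assoc)
qed (use assms in simp)

lemma (in ring_hom_cring) hom_add_pow_one: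
  "h (add_pow R (n::nat) \<one>\<^bsub>R\<^esub>) = add_pow S n \<one>\<^bsub>S\<^esub>"
  by (induction n) simp_all

section \<open>Powers of an ideal\<close>

context cring
begin

lemma ideal_power_0: "ideal_power R I 0 = carrier R"
  by (simp add: nat_pow_def ideals_set_def)

lemma ideal_power_Suc: "ideal_power R I (Suc n) = ideal_prod R (ideal_power R I n) I"
  by (simp add: nat_pow_def ideals_set_def)

lemma ideal_ideal_power:
  assumes "ideal I R"
  shows "ideal (ideal_power R I n) R"
  by (induction n) (auto simp: ideals_set_def oneideal ideal_prod_is_ideal assms)

lemma ideal_power_antimono:
  assumes "ideal I R" "m \<le> n"
  shows "ideal_power R I n \<subseteq> ideal_power R I m"
  using assms(2)
proof (induction rule: dec_induct)
  case (step n)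
  have "ideal_power R I (Suc n) \<subseteq> ideal_power R I n"
    unfolding ideal_power_Suc using ideal_prod_inter[OF ideal_ideal_power[OF assms(1)] assms(1)] by blast
  then show ?case using step by blast
qed simp

lemma ideal_power_subset:
  assumes "ideal I R"
  shows "ideal_power R I (Suc n) \<subseteq> I"
  unfolding ideal_power_Suc using ideal_prod_inter[OF ideal_ideal_power[OF assms] assms] by blast

lemma pow_mem_ideal_power:
  assumes "ideal I R" "y \<in> I"
  shows "y [^] n \<in> ideal_power R I n"
proof (induction n)
  case (Suc n)
  then show ?case using assms(2) by (simp add: ideals_set_def ideal_prod.prod)
qed (simp add: ideals_set_def)

end

section \<open>Consequences of the chain condition\<close>

text \<open>The ideals generated by the initial segments of the sequence form a chain, which in a
  Noetherian ring contains its own union.\<close>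

lemma (in noetherian_ring) mem_genideal_predecessors:
  fixes u :: "nat \<Rightarrow> 'a"
  assumes u: "\<And>n. u n \<in> carrier R"
  obtains n where "u n \<in> Idl (u ` {..<n})"
proof -
  let ?J = "\<lambda>n. Idl (u ` {..<n})"
  have sub: "u ` A \<subseteq> carrier R" for A using u by auto
  have mono: "?J m \<subseteq> ?J n" if "m \<le> n" for m n
    using that genideal_self[OF sub] by (intro genideal_minimal genideal_ideal sub) fastforce
  have "subset.chain {I. ideal I R} (range ?J)"
    unfolding subset_chain_def
  proof (intro conjI ballI)
    show "range ?J \<subseteq> {I. ideal I R}" using genideal_ideal[OF sub] by auto
    fix I J assume "I \<in> range ?J" "J \<in> range ?J"
    then obtain i j where ij: "I = ?J i" "J = ?J j" by blast
    show "I \<subseteq> J \<or> J \<subseteq> I"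
      using nat_le_linear[of i j] mono[of i j] mono[of j i] unfolding ij by blast
  qed
  then have "\<Union>(range ?J) \<in> range ?J" by (intro ideal_chain_is_trivial) auto
  then obtain n where n: "\<Union>(range ?J) = ?J n" by blast
  have "u n \<in> ?J (Suc n)" using genideal_self[OF sub, of "{..<Suc n}"] by auto
  then have "u n \<in> ?J n" using n by blast
  then show ?thesis by (rule that)
qed

text \<open>If \<open>a\<close> generated a proper ideal, an ideal maximal among the proper ones
  above it would be a maximal ideal, hence equal to \<open>\<mm>\<close>, and would contain
  \<open>a\<close>.\<close>

lemma (in noetherian_local_ring) unit_if_notin_max:
  assumes a: "a \<in> carrier R" "a \<notin> \<mm>"
  obtains b where "b \<in> carrier R" "b \<otimes> a = \<one>"
proof (cases "\<one> \<in> PIdl a")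
  case True
  then show ?thesis using that by (auto simp: cgenideal_def)
next
  case False
  let ?A = "{J. ideal J R \<and> PIdl a \<subseteq> J \<and> \<one> \<notin> J}"
  have "\<exists>J\<in>?A. \<forall>K\<in>?A. J \<subseteq> K \<longrightarrow> K = J"
  proof (rule subset_Zorn_nonempty)
    show "?A \<noteq> {}" using cgenideal_ideal[OF a(1)] False by blast
    fix C assume C: "C \<noteq> {}" "subset.chain ?A C"
    then have "subset.chain {I. ideal I R} C" unfolding subset_chain_def by blast
    then have "\<Union>C \<in> C" using C(1) by (intro ideal_chain_is_trivial)
    then show "\<Union>C \<in> ?A" using C(2) unfolding subset_chain_def by blast
  qed
  then obtain J where "J \<in> ?A" and maxA: "\<forall>K\<in>?A. J \<subseteq> K \<longrightarrow> K = J" by (rule bexE)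
  then have J: "ideal J R" "PIdl a \<subseteq> J" "\<one> \<notin> J" by simp_all
  have max: "K = J" if "ideal K R" "J \<subseteq> K" "\<one> \<notin> K" for K
  proof -
    have "K \<in> ?A" using that J(2) by simp
    then show ?thesis using maxA that(2) by blast
  qed
  have "maximalideal J R"
  proof (rule maximalidealI[OF J(1)])
    show "carrier R \<noteq> J" using J(3) one_closed by blast
    fix K assume K: "ideal K R" "J \<subseteq> K" "K \<subseteq> carrier R"
    then show "K = J \<or> K = carrier R" using max ideal.one_imp_carrier[OF K(1)] by blast
  qed
  then have "a \<in> \<mm>" using unique_maximal J(2) cgenideal_self[OF a(1)] by blast
  then show ?thesis using a(2) by contradiction
qed

text \<open>For the least \<open>k\<close> with the \<open>k\<close>-th power of
  \<open>\<mm>\<close> inside \<open>I\<close>, any element of the preceding power outside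
  \<open>I\<close> will do.\<close>

lemma (in noetherian_local_ring) power_conductor:
  assumes "ideal I R" "ideal_power R \<mm> n \<subseteq> I" "\<not> \<mm> \<subseteq> I"
  obtains b where "b \<in> carrier R" "b \<notin> I" "\<And>z. z \<in> \<mm> \<Longrightarrow> b \<otimes> z \<in> I"
proof -
  have mid: "ideal \<mm> R" using maximal by (rule maximalideal.axioms(1))
  define P where "P k \<longleftrightarrow> ideal_power R \<mm> k \<subseteq> I" for k
  have "P n" using assms(2) by (simp add: P_def)
  then obtain k where k: "P k" "\<forall>j<k. \<not> P j" using exists_least_iff[of P] by blast
  \<comment> \<open>The power with exponent 0 is the whole ring, so \<open>k\<close> has a
    predecessor.\<close>
  have "\<not> P 0"
    unfolding P_def ideal_power_0 using assms(3) ideal.Icarr[OF mid] by blast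
  then obtain j where j: "k = Suc j" using k(1) by (cases k) auto
  then have "\<not> P j" using k(2) by simp
  then obtain b where b: "b \<in> ideal_power R \<mm> j" "b \<notin> I" unfolding P_def by blast
  show ?thesis
  proof
    show "b \<in> carrier R" using b(1) ideal.Icarr[OF ideal_ideal_power[OF mid]] by blast
    show "b \<notin> I" by fact
    fix z assume "z \<in> \<mm>"
    then have "b \<otimes> z \<in> ideal_power R \<mm> k"
      unfolding j ideal_power_Suc by (rule ideal_prod.prod[OF b(1)])
    then show "b \<otimes> z \<in> I" using k(1) unfolding P_def by blast
  qed
qed

section \<open>The endomorphism ring of the maximal ideal\<close>

text \<open>The study of \<open>\<mm> : \<mm>\<close> only needs some domain \<open>L\<close> into
  which R embeds; it is applied to R_x.\<close>

locale local_extension =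
  ring_hom_cring R L h + noetherian_local_ring R \<mm> + L: domain L
  for L (structure) and R :: "('a, 'b) ring_scheme" and \<mm> and h +
  assumes inj_h: "inj_on h (carrier R)"
begin

lemma ideal_max: "ideal \<mm> R"
  using maximal by (rule maximalideal.axioms(1))

sublocale m: ideal \<mm> R by (rule ideal_max)

text \<open>\<open>M\<close> is the copy of \<open>\<mm>\<close> inside \<open>L\<close>, and \<open>T\<close> is the overring \<open>\<mm> : \<mm>\<close> of \<open>R\<close>, of which \<open>\<mm>\<close> is still an ideal.\<close>

definition M where "M = h ` \<mm>"

definition T where "T = {t \<in> carrier L. \<forall>y\<in>M. t \<otimes> y \<in> M}"

lemma h_mem_iff: "I \<subseteq> carrier R \<Longrightarrow> a \<in> carrier R \<Longrightarrow> h a \<in> h ` I \<longleftrightarrow> a \<in> I"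
  using inj_h by (auto dest: inj_onD)

lemma one_notin_max: "\<one>\<^bsub>R\<^esub> \<notin> \<mm>"
  using maximal m.one_imp_carrier maximalideal.I_notcarr by blast

lemma h_mem_M_iff: "a \<in> carrier R \<Longrightarrow> h a \<in> M \<longleftrightarrow> a \<in> \<mm>"
  unfolding M_def by (rule h_mem_iff) (auto intro: m.Icarr)

lemma h_mem_M: "a \<in> \<mm> \<Longrightarrow> h a \<in> M"
  by (simp add: M_def)

lemma one_notin_M: "\<one> \<notin> M"
  using h_mem_M_iff[OF R.one_closed] one_notin_max by simp

lemma M_subset: "M \<subseteq> h ` carrier R"
  using m.a_subset by (auto simp: M_def)

lemma M_closed: "y \<in> M \<Longrightarrow> y \<in> carrier L"
  using m.Icarr by (auto simp: M_def)

lemma M_add: "y \<in> M \<Longrightarrow> z \<in> M \<Longrightarrow> y \<oplus> z \<in> M"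
  unfolding M_def by (auto intro: m.Icarr) (metis hom_add image_eqI m.Icarr m.a_closed)

lemma M_neg: "y \<in> M \<Longrightarrow> \<ominus> y \<in> M"
  unfolding M_def by (auto intro: m.Icarr) (metis hom_a_inv image_eqI m.Icarr m.a_inv_closed)

lemma M_minus: "y \<in> M \<Longrightarrow> z \<in> M \<Longrightarrow> y \<ominus> z \<in> M"
  by (simp add: a_minus_def M_add M_neg)

lemma add_mem_M_iff:
  assumes "y \<in> M" "t \<in> carrier L"
  shows "t \<oplus> y \<in> M \<longleftrightarrow> t \<in> M"
proof
  assume "t \<oplus> y \<in> M"
  then have "(t \<oplus> y) \<ominus> y \<in> M" using assms(1) by (rule M_minus)
  moreover have "(t \<oplus> y) \<ominus> y = t" using assms M_closed by (simp add: a_minus_def S.a_assoc S.r_neg)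
  ultimately show "t \<in> M" by simp
qed (use assms M_add in blast)

lemma T_carrier: "t \<in> T \<Longrightarrow> t \<in> carrier L"
  by (simp add: T_def)

lemma T_M: "t \<in> T \<Longrightarrow> y \<in> M \<Longrightarrow> t \<otimes> y \<in> M"
  by (simp add: T_def)

lemma h_T: "a \<in> carrier R \<Longrightarrow> h a \<in> T"
proof -
  assume a: "a \<in> carrier R"
  have "h a \<otimes> h y \<in> h ` \<mm>" if "y \<in> \<mm>" for y
    using hom_mult[OF a m.Icarr[OF that]] m.I_l_closed[OF that a] by (metis imageI)
  then show ?thesis using a by (auto simp: T_def M_def)
qed

lemma one_T: "\<one> \<in> T"
  using h_T[OF R.one_closed] by simp

lemma T_mult: "s \<in> T \<Longrightarrow> t \<in> T \<Longrightarrow> s \<otimes> t \<in> T"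
  unfolding T_def by (auto simp: S.m_assoc M_closed)

lemma T_add: "s \<in> T \<Longrightarrow> t \<in> T \<Longrightarrow> s \<oplus> t \<in> T"
  unfolding T_def by (auto simp: S.l_distr M_closed M_add)

lemma T_neg: "t \<in> T \<Longrightarrow> \<ominus> t \<in> T"
  unfolding T_def by (auto simp: S.l_minus M_closed M_neg)

lemma T_minus: "s \<in> T \<Longrightarrow> t \<in> T \<Longrightarrow> s \<ominus> t \<in> T"
  by (simp add: a_minus_def T_add T_neg)

lemma T_pow: "t \<in> T \<Longrightarrow> t [^] (n::nat) \<in> T"
  by (induction n) (auto simp: one_T T_mult)

lemmas T_closed = h_T one_T T_mult T_add T_neg T_minus T_pow

lemma T_eval:
  assumes "t \<in> T" "set as \<subseteq> carrier R"
  shows "S.eval (map h as) t \<in> T"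
  using assms(2) by (induction as) (use assms(1) h_T[OF R.zero_closed] in \<open>auto intro!: T_closed\<close>)

section \<open>Integrality of \<open>T\<close> over R\<close>

text \<open>The ideals generated by \<open>y, t y, \<dots>, t\<^sup>n y\<close> form an ascending chain in \<open>R\<close>.\<close>

lemma integral_relation:
  assumes t: "t \<in> T" and y: "y \<in> \<mm>" "y \<noteq> \<zero>\<^bsub>R\<^esub>"
  obtains rs where "set rs \<subseteq> carrier R" "S.eval (\<one> # map h rs) t = \<zero>"
proof -
  have tc [simp]: "t \<in> carrier L" using t by (rule T_carrier)
  have yc [simp]: "y \<in> carrier R" using y(1) by (rule m.Icarr)
  have "\<forall>n. \<exists>u\<in>\<mm>. h u = t [^] (n::nat) \<otimes> h y"
    using T_M[OF T_pow[OF t] h_mem_M[OF y(1)]] unfolding M_def by (metis imageE)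
  then obtain u where u: "\<And>n::nat. u n \<in> \<mm>" "\<And>n. h (u n) = t [^] n \<otimes> h y" by metis
  have uc: "\<And>n. u n \<in> carrier R" using u(1) m.Icarr by blast
  obtain n where n: "u n \<in> Idl\<^bsub>R\<^esub> (u ` {..<n})"
    using mem_genideal_predecessors[of u, OF uc] by blast
  \<comment> \<open>\<open>J\<close> collects the elements of the form q(t) y with q of degree below
    \<open>n\<close>. It is an ideal containing \<open>u i\<close> for \<open>i < n\<close>, so it
    contains \<open>u n\<close>.\<close>
  define J where "J = {w \<in> carrier R. \<exists>rs. set rs \<subseteq> carrier R \<and> length rs = n \<and>
    h w = S.eval (map h rs) t \<otimes> h y}"
  have evc: "S.eval (map h rs) t \<in> carrier L" if "set rs \<subseteq> carrier R" for rs
    using that by (intro S.eval_in_carrier) auto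
  have J_add: "v \<oplus>\<^bsub>R\<^esub> w \<in> J" if vw: "v \<in> J" "w \<in> J" for v w
  proof -
    obtain p q where pq: "set p \<subseteq> carrier R" "length p = n" "h v = S.eval (map h p) t \<otimes> h y"
      "set q \<subseteq> carrier R" "length q = n" "h w = S.eval (map h q) t \<otimes> h y"
      using vw by (auto simp: J_def)
    have "map h (map2 (\<oplus>\<^bsub>R\<^esub>) p q) = map2 (\<oplus>) (map h p) (map h q)"
      using pq(1,2,4,5) by (intro nth_equalityI) (auto simp: subset_iff)
    moreover have "S.eval (map2 (\<oplus>) (map h p) (map h q)) t =
      S.eval (map h p) t \<oplus> S.eval (map h q) t"
      using pq by (intro S.eval_map2_add) auto
    moreover have "set (map2 (\<oplus>\<^bsub>R\<^esub>) p q) \<subseteq> carrier R"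
    proof
      fix z assume "z \<in> set (map2 (\<oplus>\<^bsub>R\<^esub>) p q)"
      then obtain a b where "(a, b) \<in> set (zip p q)" "z = a \<oplus>\<^bsub>R\<^esub> b" by auto
      then show "z \<in> carrier R"
        using pq(1,4) set_zip_leftD[of a b p q] set_zip_rightD[of a b p q] by blast
    qed
    moreover have "v \<in> carrier R" "w \<in> carrier R" using vw by (auto simp: J_def)
    ultimately show ?thesis using pq evc
      by (auto simp: J_def S.l_distr intro!: exI[of _ "map2 (\<oplus>\<^bsub>R\<^esub>) p q"])
  qed
  have J_mult: "r \<otimes>\<^bsub>R\<^esub> w \<in> J" if w: "w \<in> J" and r: "r \<in> carrier R" for r w
  proof -
    obtain q where q: "set q \<subseteq> carrier R" "length q = n" "h w = S.eval (map h q) t \<otimes> h y"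
      using w by (auto simp: J_def)
    let ?q = "map ((\<otimes>\<^bsub>R\<^esub>) r) q"
    have "map h ?q = map ((\<otimes>) (h r)) (map h q)"
      using q(1) r by (auto simp: subset_iff)
    then have "S.eval (map h ?q) t = h r \<otimes> S.eval (map h q) t"
      using S.eval_map_mult[of "map h q" t "h r"] q r by (auto simp del: map_map)
    then have "h (r \<otimes>\<^bsub>R\<^esub> w) = S.eval (map h ?q) t \<otimes> h y"
      using q evc[OF q(1)] r w by (simp add: J_def S.m_assoc del: map_map)
    moreover have "w \<in> carrier R" using w by (auto simp: J_def)
    moreover have "set ?q \<subseteq> carrier R" using q(1) r by auto
    moreover have "length ?q = n" using q(2) by simp
    ultimately show ?thesis using r unfolding J_def by blast
  qed
  have u_J: "u i \<in> J" if "i < n" for i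
  proof -
    \<comment> \<open>The monomial of degree \<open>i\<close>, padded with leading zeros to length
      \<open>n\<close>.\<close>
    let ?q = "replicate (n - Suc i) \<zero>\<^bsub>R\<^esub> @ (\<one>\<^bsub>R\<^esub> # replicate i \<zero>\<^bsub>R\<^esub>)"
    have "S.eval (map h ?q) t = S.eval (\<one> # replicate i \<zero>) t"
      using S.eval_replicate[OF _ tc, of "\<one> # replicate i \<zero>" "n - Suc i"]
      by (auto simp: set_replicate_conv_if simp del: S.eval.simps split: if_splits)
    also have "\<dots> = t [^] i"
      using S.eval_monom[of \<one> t i] by (simp add: monom_def)
    finally show ?thesis
      using that u(2) uc by (auto simp: J_def intro!: exI[of _ ?q])
  qed
  have J_zero: "\<zero>\<^bsub>R\<^esub> \<in> J"
  proof -
    have "S.eval (map h (replicate n \<zero>\<^bsub>R\<^esub>)) t = \<zero>"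
      using S.eval_replicate[of "[]" t n] by simp
    then show ?thesis by (auto simp: J_def intro!: exI[of _ "replicate n \<zero>\<^bsub>R\<^esub>"])
  qed
  have J_neg: "\<ominus>\<^bsub>R\<^esub> w \<in> J" if "w \<in> J" for w
  proof -
    have "w \<in> carrier R" using that by (auto simp: J_def)
    then have "\<ominus>\<^bsub>R\<^esub> w = \<ominus>\<^bsub>R\<^esub> \<one>\<^bsub>R\<^esub> \<otimes>\<^bsub>R\<^esub> w" by (simp add: R.l_minus)
    then show ?thesis using J_mult[OF that, of "\<ominus>\<^bsub>R\<^esub> \<one>\<^bsub>R\<^esub>"] by simp
  qed
  have Jc: "J \<subseteq> carrier R" by (auto simp: J_def)
  have "ideal J R"
  proof (rule idealI[OF R.ring_axioms])
    show "subgroup J (add_monoid R)"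
      using Jc J_add J_zero J_neg by unfold_locales (auto simp: a_inv_def[symmetric])
    fix w r assume "w \<in> J" "r \<in> carrier R"
    then show "r \<otimes>\<^bsub>R\<^esub> w \<in> J" "w \<otimes>\<^bsub>R\<^esub> r \<in> J"
      using J_mult[of w r] R.m_comm[of w r] Jc by auto
  qed
  then have "Idl\<^bsub>R\<^esub> (u ` {..<n}) \<subseteq> J"
    by (rule R.genideal_minimal) (use u_J in auto)
  \<comment> \<open>Expanding the negative of \<open>u n\<close> makes the resulting relation
    monic.\<close>
  then have "\<ominus>\<^bsub>R\<^esub> u n \<in> J" using n J_neg by blast
  then obtain rs where rs: "set rs \<subseteq> carrier R" "length rs = n"
    "h (\<ominus>\<^bsub>R\<^esub> u n) = S.eval (map h rs) t \<otimes> h y" by (auto simp: J_def)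
  have "S.eval (\<one> # map h rs) t \<otimes> h y = h (u n) \<oplus> h (\<ominus>\<^bsub>R\<^esub> u n)"
    using rs evc[OF rs(1)] u(2) by (simp add: S.l_distr)
  also have "\<dots> = \<zero>" using uc by (simp add: S.r_neg)
  finally have "S.eval (\<one> # map h rs) t \<otimes> h y = \<zero>" .
  moreover have "h y \<noteq> \<zero>"
    using y(2) inj_h hom_zero inj_onD[OF inj_h, of y "\<zero>\<^bsub>R\<^esub>"] by auto
  moreover have "S.eval (\<one> # map h rs) t \<in> carrier L" using evc[OF rs(1)] by simp
  ultimately have "S.eval (\<one> # map h rs) t = \<zero>" by (simp add: L.integral_iff)
  then show ?thesis using rs(1) that by blast
qed

section \<open>Linear factors and roots in the residue field\<close>

text \<open>Horner's scheme for dividing a monic polynomial by X - c: the quotient is monic of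
  smaller degree and the remainder is the value at \<open>c\<close>. Appending a coefficient
  \<open>a\<close> to the polynomial appends its previous value at \<open>c\<close> to the
  quotient.\<close>

lemma divide_linear:
  assumes "set rs \<subseteq> carrier R" "rs \<noteq> []" "c \<in> carrier R"
  obtains bs where "set bs \<subseteq> carrier R" "length bs < length rs"
    "\<And>t. t \<in> carrier L \<Longrightarrow> S.eval (\<one> # map h rs) t =
      (t \<ominus> h c) \<otimes> S.eval (\<one> # map h bs) t \<oplus> h (R.eval (\<one>\<^bsub>R\<^esub> # rs) c)"
proof -
  have "\<exists>bs. set bs \<subseteq> carrier R \<and> length bs < length rs \<and>
    (\<forall>t\<in>carrier L. S.eval (\<one> # map h rs) t =
      (t \<ominus> h c) \<otimes> S.eval (\<one> # map h bs) t \<oplus> h (R.eval (\<one>\<^bsub>R\<^esub> # rs) c))"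
    using assms(2,1)
  proof (induction rs rule: rev_nonempty_induct)
    case (single a)
    then have a: "a \<in> carrier R" by simp
    have "S.eval (\<one> # map h [a]) t =
      (t \<ominus> h c) \<otimes> S.eval (\<one> # map h []) t \<oplus> h (R.eval (\<one>\<^bsub>R\<^esub> # [a]) c)"
      if t: "t \<in> carrier L" for t
    proof -
      have "S.eval (\<one> # map h [a]) t = t \<oplus> h a" using t a by simp
      also have "\<dots> = t \<ominus> h c \<oplus> (h c \<oplus> h a)"
        using t a assms(3) by (simp add: a_minus_def S.a_assoc S.r_neg1)
      also have "\<dots> = (t \<ominus> h c) \<otimes> S.eval (\<one> # map h []) t \<oplus> h (R.eval (\<one>\<^bsub>R\<^esub> # [a]) c)"
        using t a assms(3) by simp
      finally show ?thesis .
    qed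
    then show ?case by (intro exI[of _ "[]"] conjI ballI) simp_all
  next
    case (snoc a rs)
    then have a: "a \<in> carrier R" and rs: "set rs \<subseteq> carrier R" by auto
    obtain bs where bs: "set bs \<subseteq> carrier R" "length bs < length rs" and
      ev: "\<And>t. t \<in> carrier L \<Longrightarrow> S.eval (\<one> # map h rs) t =
        (t \<ominus> h c) \<otimes> S.eval (\<one> # map h bs) t \<oplus> h (R.eval (\<one>\<^bsub>R\<^esub> # rs) c)"
      using snoc by auto
    let ?v = "R.eval (\<one>\<^bsub>R\<^esub> # rs) c"
    have v: "?v \<in> carrier R" using rs assms(3) by (intro R.eval_in_carrier) auto
    have "S.eval (\<one> # map h (rs @ [a])) t =
      (t \<ominus> h c) \<otimes> S.eval (\<one> # map h (bs @ [?v])) t \<oplus> h (R.eval (\<one>\<^bsub>R\<^esub> # rs @ [a]) c)"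
      if t: "t \<in> carrier L" for t
    proof -
      let ?E = "S.eval (\<one> # map h bs) t"
      have E: "?E \<in> carrier L" using bs(1) t by (intro S.eval_in_carrier) auto
      have 1: "S.eval (\<one> # map h (rs @ [a])) t = S.eval (\<one> # map h rs) t \<otimes> t \<oplus> h a"
        using S.eval_append_aux[of "\<one> # map h rs" "h a" t] rs a t by auto
      have 2: "S.eval (\<one> # map h (bs @ [?v])) t = ?E \<otimes> t \<oplus> h ?v"
        using S.eval_append_aux[of "\<one> # map h bs" "h ?v" t] bs(1) v t by auto
      have 3: "R.eval (\<one>\<^bsub>R\<^esub> # rs @ [a]) c = ?v \<otimes>\<^bsub>R\<^esub> c \<oplus>\<^bsub>R\<^esub> a"
        using R.eval_append_aux[of "\<one>\<^bsub>R\<^esub> # rs" a c] rs a assms(3) by auto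
      have *: "((t \<ominus> d) \<otimes> E \<oplus> w) \<otimes> t \<oplus> b = (t \<ominus> d) \<otimes> (E \<otimes> t \<oplus> w) \<oplus> (w \<otimes> d \<oplus> b)"
        if "d \<in> carrier L" "E \<in> carrier L" "w \<in> carrier L" "b \<in> carrier L" for d E w b
        using that t by algebra
      show ?thesis
        unfolding 1 2 3 ev[OF t] using *[OF _ E, of "h c" "h ?v" "h a"] v a assms(3) by simp
    qed
    then show ?case using bs v by (intro exI[of _ "bs @ [?v]"]) auto
  qed
  then show ?thesis using that by blast
qed

text \<open>The leading coefficient stays nonzero modulo \<open>\<mm>\<close>, so the reduced
  polynomial has positive degree and splits over the residue field; \<open>c\<close> lifts one of
  its roots.\<close>

lemma residue_root:
  assumes "algebraically_closed (R Quot \<mm>)" "set rs \<subseteq> carrier R" "rs \<noteq> []"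
  obtains c where "c \<in> carrier R" "R.eval (\<one>\<^bsub>R\<^esub> # rs) c \<in> \<mm>"
proof -
  have quot: "carrier (R Quot \<mm>) = (+>\<^bsub>R\<^esub>) \<mm> ` carrier R" "\<zero>\<^bsub>R Quot \<mm>\<^esub> = \<mm>"
    by (auto simp: FactRing_def A_RCOSETS_def')
  interpret Q: algebraically_closed "R Quot \<mm>" by fact
  interpret q: ring_hom_ring R "R Quot \<mm>" "(+>\<^bsub>R\<^esub>) \<mm>" by (rule m.rcos_ring_hom_ring)
  let ?p = "map ((+>\<^bsub>R\<^esub>) \<mm>) (\<one>\<^bsub>R\<^esub> # rs)"
  have p: "?p \<in> carrier (poly_ring (R Quot \<mm>))"
    using assms(2) Q.one_not_zero unfolding univ_poly_carrier[symmetric] polynomial_def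
    by (auto simp: q.hom_one)
  have "size (Q.roots ?p) = length rs"
    using Q.roots_over_carrier[OF p] by (simp add: Q.splitted_def)
  then obtain z where "z \<in># Q.roots ?p"
    using assms(3) by (metis length_0_conv multiset_nonemptyE size_empty)
  then have "Q.is_root ?p z" using p Q.roots_mem_iff_is_root by blast
  then have z: "z \<in> carrier (R Quot \<mm>)" "Q.eval ?p z = \<zero>\<^bsub>R Quot \<mm>\<^esub>"
    unfolding Q.is_root_def by blast+
  obtain c where c: "c \<in> carrier R" "z = \<mm> +>\<^bsub>R\<^esub> c"
    using z(1) unfolding quot(1) by blast
  have "\<mm> +>\<^bsub>R\<^esub> R.eval (\<one>\<^bsub>R\<^esub> # rs) c = Q.eval ?p z"
    unfolding c(2) by (rule q.eval_hom'[OF c(1)]) (use assms(2) in auto)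
  also have "\<dots> = \<mm>" unfolding z(2) by (rule quot(2))
  finally have "\<mm> +>\<^bsub>R\<^esub> R.eval (\<one>\<^bsub>R\<^esub> # rs) c = \<mm>" .
  moreover have "R.eval (\<one>\<^bsub>R\<^esub> # rs) c \<in> carrier R"
    using c(1) assms(2) by (intro R.eval_in_carrier) auto
  ultimately show ?thesis using c(1) that m.rcos_const_imp_mem by blast
qed

section \<open>Idempotents modulo the maximal ideal\<close>

lemma pow_minus_self_mem:
  assumes e: "e \<in> T" "e \<otimes> e \<ominus> e \<in> M"
  shows "e [^] Suc k \<ominus> e \<in> M"
proof (induction k)
  case 0
  then show ?case using h_mem_M[OF m.zero_closed] T_carrier[OF e(1)] by (simp add: a_minus_def S.r_neg)
next
  case (Suc k)
  have ec: "e \<in> carrier L" using e(1) by (rule T_carrier)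
  have "e [^] Suc k \<in> carrier L" using ec by simp
  then have "e [^] Suc k \<otimes> e \<ominus> e = e \<otimes> (e [^] Suc k \<ominus> e) \<oplus> (e \<otimes> e \<ominus> e)"
    using ec by algebra
  then show ?case using M_add[OF T_M[OF e(1) Suc] e(2)] by simp
qed

text \<open>Multiplication by \<open>t\<close> is absorbed by the last factor of a product, which
  lies in \<open>\<mm>\<close>. The exponent must be positive for this: the power with exponent 0 is
  R, whose stability under \<open>T\<close> is not yet known.\<close>

lemma T_ideal_power:
  assumes t: "t \<in> T" and y: "y \<in> h ` ideal_power R \<mm> (Suc n)"
  shows "t \<otimes> y \<in> h ` ideal_power R \<mm> (Suc n)"
proof -
  have tc: "t \<in> carrier L" using t by (rule T_carrier)
  have id: "ideal (ideal_power R \<mm> n) R" by (rule R.ideal_ideal_power[OF ideal_max])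
  have cl: "z \<in> carrier R" if "z \<in> ideal_prod R (ideal_power R \<mm> n) \<mm>" for z
    using R.ideal_prod_in_carrier[OF id ideal_max] that by blast
  have "t \<otimes> h z \<in> h ` ideal_prod R (ideal_power R \<mm> n) \<mm>"
    if "z \<in> ideal_prod R (ideal_power R \<mm> n) \<mm>" for z
    using that
  proof induction
    case (prod i j)
    obtain k where k: "k \<in> \<mm>" "t \<otimes> h j = h k"
      using T_M[OF t h_mem_M[OF prod(2)]] by (auto simp: M_def)
    have "i \<in> carrier R" "j \<in> carrier R" "k \<in> carrier R"
      using prod k(1) m.Icarr ideal.Icarr[OF id] by auto
    then have "t \<otimes> h (i \<otimes>\<^bsub>R\<^esub> j) = h (i \<otimes>\<^bsub>R\<^esub> k)"
      using tc k(2)[symmetric] S.m_lcomm[of t "h i" "h j"] by simp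
    then show ?case using ideal_prod.prod[OF prod(1) k(1), of R] by (metis imageI)
  next
    case (sum v w)
    obtain v' w' where "v' \<in> ideal_prod R (ideal_power R \<mm> n) \<mm>" "t \<otimes> h v = h v'"
      "w' \<in> ideal_prod R (ideal_power R \<mm> n) \<mm>" "t \<otimes> h w = h w'"
      using sum.IH by auto
    moreover from this have "t \<otimes> h (v \<oplus>\<^bsub>R\<^esub> w) = h (v' \<oplus>\<^bsub>R\<^esub> w')"
      using cl sum.hyps tc by (simp add: S.r_distr)
    ultimately show ?case by (metis ideal_prod.sum imageI)
  qed
  then show ?thesis using y unfolding R.ideal_power_Suc by auto
qed

lemma M_pow:
  assumes "y \<in> M" "n \<le> k"
  shows "y [^] k \<in> h ` ideal_power R \<mm> n"
proof -
  obtain z where z: "z \<in> \<mm>" "y = h z" using assms(1) by (auto simp: M_def)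
  have "z [^]\<^bsub>R\<^esub> k \<in> ideal_power R \<mm> n"
    using R.pow_mem_ideal_power[OF ideal_max z(1)] R.ideal_power_antimono[OF ideal_max assms(2)] by blast
  moreover have "y [^] k = h (z [^]\<^bsub>R\<^esub> k)" using z m.Icarr by simp
  ultimately show ?thesis by blast
qed

text \<open>For an idempotent \<open>e\<close> modulo \<open>\<mm>\<close>, the sequence \<open>e^(p^n)\<close> converges to an honest idempotent, and
  a domain has only the trivial ones.\<close>

lemma idempotent_mod_max:
  assumes complete: "adically_complete R \<mm>"
    and p: "Factorial_Ring.prime (p::nat)" "add_pow L p \<one> = \<zero>"
    and e: "e \<in> T" "e \<otimes> e \<ominus> e \<in> M"
  shows "e \<in> M \<or> e \<ominus> \<one> \<in> M"
proof -
  let ?I = "ideal_power R \<mm>"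
  have Iid: "ideal (?I n) R" for n by (rule R.ideal_ideal_power[OF ideal_max])
  have Ic: "?I n \<subseteq> carrier R" for n using ideal.Icarr[OF Iid] by blast
  have ec [simp]: "e \<in> carrier L" using e(1) by (rule T_carrier)
  define d where "d = e \<otimes> e \<ominus> e"
  have le_pow: "n \<le> p ^ n" for n
    using prime_gt_1_nat[OF p(1)] by (simp add: less_imp_le power_gt_expt)
  have pow_minus: "e [^] k \<ominus> e \<in> M" if "k \<noteq> 0" for k :: nat
    using pow_minus_self_mem[OF e, of "k - 1"] that by (simp del: nat_pow_Suc S.nat_pow_Suc)
  \<comment> \<open>The powers of \<open>e\<close> lie only in \<open>T\<close>, but completeness
    concerns sequences in R; their differences from \<open>e\<close> lie in \<open>M\<close> and so
    come from R.\<close>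
  have "\<forall>n. \<exists>s\<in>\<mm>. h s = e [^] (p ^ n) \<ominus> e"
  proof
    fix n
    have "e [^] (p ^ n) \<ominus> e \<in> M" using pow_minus prime_gt_0_nat[OF p(1)] by simp
    then show "\<exists>s\<in>\<mm>. h s = e [^] (p ^ n) \<ominus> e" unfolding M_def by (metis imageE)
  qed
  then obtain s where s: "\<And>n. s n \<in> \<mm>" "\<And>n. h (s n) = e [^] (p ^ n) \<ominus> e" by metis
  have sc [simp]: "s n \<in> carrier R" for n using s(1) m.Icarr by blast
  \<comment> \<open>By Frobenius the difference is the p^N-th power of an element of
    \<open>M\<close>, and p^N is at least \<open>N\<close>.\<close>
  have step: "s (N + k) \<ominus>\<^bsub>R\<^esub> s N \<in> ?I N" for N k
  proof -
    have "h (s (N + k) \<ominus>\<^bsub>R\<^esub> s N) = (e [^] (p ^ (N + k)) \<ominus> e) \<ominus> (e [^] (p ^ N) \<ominus> e)"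
      using s(2) by (simp add: R.minus_eq S.minus_eq)
    also have "\<dots> = e [^] (p ^ (N + k)) \<ominus> e [^] (p ^ N)"
      by (simp add: S.minus_eq S.minus_add S.a_ac S.r_neg S.r_neg2)
    also have "\<dots> = (e [^] (p ^ k) \<ominus> e) [^] (p ^ N)"
      using S.frobenius_minus[OF p, of "e [^] (p ^ k)" e N]
      by (simp add: S.nat_pow_pow power_add mult.commute)
    also have "\<dots> \<in> h ` ?I N"
      using pow_minus[of "p ^ k"] prime_gt_0_nat[OF p(1)] le_pow by (intro M_pow) auto
    finally show ?thesis by (rule h_mem_iff[OF Ic, THEN iffD1, rotated]) simp
  qed
  have cauchy: "s i \<ominus>\<^bsub>R\<^esub> s j \<in> ?I N" if "N \<le> i" "N \<le> j" for i j N
  proof -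
    have "s i \<ominus>\<^bsub>R\<^esub> s N \<in> ?I N" "s j \<ominus>\<^bsub>R\<^esub> s N \<in> ?I N"
      using step[of N "i - N"] step[of N "j - N"] that by auto
    then have "(s i \<ominus>\<^bsub>R\<^esub> s N) \<oplus>\<^bsub>R\<^esub> \<ominus>\<^bsub>R\<^esub> (s j \<ominus>\<^bsub>R\<^esub> s N) \<in> ?I N"
      using Iid[of N] by (simp add: ideal.axioms(1) additive_subgroup.a_closed additive_subgroup.a_inv_closed)
    moreover have "(s i \<ominus>\<^bsub>R\<^esub> s N) \<oplus>\<^bsub>R\<^esub> \<ominus>\<^bsub>R\<^esub> (s j \<ominus>\<^bsub>R\<^esub> s N) = s i \<ominus>\<^bsub>R\<^esub> s j"
      by (simp add: R.minus_eq R.minus_add R.a_ac R.r_neg R.r_neg2)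
    ultimately show ?thesis by simp
  qed
  have "s \<in> UNIV \<rightarrow> carrier R" by simp
  then obtain l where l: "l \<in> carrier R" "\<And>n. \<exists>N. \<forall>i\<ge>N. s i \<ominus>\<^bsub>R\<^esub> l \<in> ?I n"
    using complete cauchy unfolding adically_complete_def by metis
  have "\<exists>i. n \<le> i \<and> s i \<ominus>\<^bsub>R\<^esub> l \<in> ?I n" for n
    using l(2)[of n] by (metis nle_le)
  then obtain i where i: "\<And>n. n \<le> i n" "\<And>n. s (i n) \<ominus>\<^bsub>R\<^esub> l \<in> ?I n" by metis
  have lM: "l \<in> \<mm>"
  proof -
    have "s (i 1) \<ominus>\<^bsub>R\<^esub> l \<in> \<mm>" using i(2)[of 1] R.ideal_power_subset[OF ideal_max, of 0] by auto
    then have "s (i 1) \<oplus>\<^bsub>R\<^esub> \<ominus>\<^bsub>R\<^esub> (s (i 1) \<ominus>\<^bsub>R\<^esub> l) \<in> \<mm>" using s(1) by simp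
    then show ?thesis using l(1) by (simp add: R.minus_eq R.minus_add R.r_neg2)
  qed
  \<comment> \<open>\<open>E\<close> is the limit of the powers e^(p^n) and is congruent to
    \<open>e\<close> modulo \<open>M\<close>.\<close>
  define E where "E = e \<oplus> h l"
  have Ec [simp]: "E \<in> carrier L" using l(1) by (simp add: E_def)
  have mem: "E \<otimes> E \<ominus> E \<in> h ` ?I n" for n
  proof -
    \<comment> \<open>The successor provides the positive exponent required by
      \<open>T_ideal_power\<close>.\<close>
    let ?n = "Suc n"
    define f where "f = e [^] (p ^ i ?n)"
    define g where "g = h (s (i ?n) \<ominus>\<^bsub>R\<^esub> l)"
    have fc: "f \<in> carrier L" and gc: "g \<in> carrier L" using l(1) by (auto simp: f_def g_def)
    have fT: "f \<in> T" unfolding f_def using e(1) by (rule T_pow)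
    have gT: "g \<in> T" unfolding g_def using l(1) by (intro h_T) simp
    have g: "g = (f \<ominus> e) \<ominus> h l" using s(2) l(1) by (simp add: f_def g_def R.minus_eq S.minus_eq)
    have Ef: "E = f \<ominus> g"
      unfolding g E_def using fc ec hom_closed[OF l(1)] by algebra
    \<comment> \<open>Here \<open>f\<close> is a power of \<open>e\<close> approximating
      \<open>E\<close> and \<open>g\<close> is the error. The first summand is a high power of
      \<open>d\<close>, and the second is a multiple of the error by an element of
      \<open>T\<close>.\<close>
    have eq: "E \<otimes> E \<ominus> E = (f \<otimes> f \<ominus> f) \<oplus> (\<one> \<ominus> (f \<oplus> E)) \<otimes> g"
      unfolding Ef using fc gc by algebra
    have "f \<otimes> f \<ominus> f = d [^] (p ^ i ?n)"
      unfolding f_def d_def using S.frobenius_minus[OF p, of "e \<otimes> e" e "i ?n"]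
      by (simp add: S.nat_pow_distrib)
    also have "\<dots> \<in> h ` ?I ?n"
      using e(2) order.trans[OF i(1) le_pow] by (intro M_pow) (auto simp: d_def)
    finally have 1: "f \<otimes> f \<ominus> f \<in> h ` ?I ?n" .
    have "\<one> \<ominus> (f \<oplus> E) \<in> T" unfolding Ef by (intro T_closed fT gT)
    then have 2: "(\<one> \<ominus> (f \<oplus> E)) \<otimes> g \<in> h ` ?I ?n"
      unfolding g_def by (intro T_ideal_power imageI i(2))
    obtain v w where vw: "v \<in> ?I ?n" "w \<in> ?I ?n" "E \<otimes> E \<ominus> E = h v \<oplus> h w"
      using 1 2 eq by auto
    then have "E \<otimes> E \<ominus> E = h (v \<oplus>\<^bsub>R\<^esub> w)" using Ic by (metis hom_add subsetD)
    moreover have "v \<oplus>\<^bsub>R\<^esub> w \<in> ?I ?n"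
      using vw(1,2) by (intro additive_subgroup.a_closed ideal.axioms(1) Iid)
    then have "v \<oplus>\<^bsub>R\<^esub> w \<in> ?I n"
      using R.ideal_power_antimono[OF ideal_max, of n ?n] by auto
    ultimately show ?thesis by blast
  qed
  obtain z where z: "z \<in> carrier R" "E \<otimes> E \<ominus> E = h z"
    using mem[of 0] unfolding R.ideal_power_0 by blast
  have "z \<in> ?I n" for n using mem[of n] z h_mem_iff[OF Ic z(1)] by simp
  then have "z = \<zero>\<^bsub>R\<^esub>" using complete unfolding adically_complete_def by blast
  then have "E \<otimes> E \<ominus> E = \<zero>" using z(2) by simp
  then have "E \<otimes> (E \<ominus> \<one>) = \<zero>" by (simp add: S.minus_eq S.r_distr S.r_minus)
  then have "E = \<zero> \<or> E = \<one>" by (simp add: L.integral_iff S.r_right_minus_eq)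
  then show ?thesis
  proof
    assume "E = \<zero>"
    then show ?thesis using add_mem_M_iff[OF h_mem_M[OF lM], of e] h_mem_M[OF m.zero_closed]
      by (simp add: E_def)
  next
    assume "E = \<one>"
    have "(e \<ominus> \<one>) \<oplus> h l = E \<ominus> \<one>"
      unfolding E_def using ec hom_closed[OF l(1)] by algebra
    then have "(e \<ominus> \<one>) \<oplus> h l = \<zero>" using \<open>E = \<one>\<close> by (simp add: S.minus_eq S.r_neg)
    then show ?thesis using add_mem_M_iff[OF h_mem_M[OF lM], of "e \<ominus> \<one>"] h_mem_M[OF m.zero_closed]
      by simp
  qed
qed

section \<open>Units and nilpotents modulo the maximal ideal\<close>

lemma unit_factor:
  assumes t: "t \<in> T" and as: "set as \<subseteq> carrier R" "\<exists>a\<in>set as. a \<notin> \<mm>"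
    and rel: "t [^] (i::nat) \<otimes> S.eval (map h as) t \<in> M"
  obtains j :: nat and s where "s \<in> T" "t [^] j \<otimes> (\<one> \<ominus> t \<otimes> s) \<in> M"
proof -
  have tc [simp]: "t \<in> carrier L" using t by (rule T_carrier)
  have "\<exists>j::nat. \<exists>s\<in>T. t [^] j \<otimes> (\<one> \<ominus> t \<otimes> s) \<in> M"
    using as rel
  proof (induction as arbitrary: i rule: rev_induct)
    case (snoc a as)
    have a: "a \<in> carrier R" and as: "set as \<subseteq> carrier R" using snoc.prems by auto
    define E where "E = S.eval (map h as) t"
    have ET: "E \<in> T" unfolding E_def using t as by (rule T_eval)
    have Ec: "E \<in> carrier L" using ET by (rule T_carrier)
    have "S.eval (map h (as @ [a])) t = E \<otimes> t \<oplus> h a"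
      using S.eval_append_aux[of "map h as" "h a" t] as a by (auto simp: E_def)
    then have rel: "t [^] i \<otimes> (E \<otimes> t \<oplus> h a) \<in> M" using snoc.prems(3) by simp
    have tic: "t [^] i \<in> carrier L" by simp
    show ?case
    proof (cases "a \<in> \<mm>")
      case True
      have "t [^] i \<otimes> (E \<otimes> t \<oplus> h a) = t [^] Suc i \<otimes> E \<oplus> t [^] i \<otimes> h a"
        using Ec a by (simp add: S.r_distr S.m_ac)
      then have "t [^] Suc i \<otimes> E \<in> M"
        using rel add_mem_M_iff[OF T_M[OF T_pow[OF t, of i] h_mem_M[OF True]], of "t [^] Suc i \<otimes> E"] Ec by simp
      then show ?thesis
        using snoc.IH[of "Suc i"] as snoc.prems(2) True by (auto simp: E_def)
    next
      case False
      obtain b where b: "b \<in> carrier R" "b \<otimes>\<^bsub>R\<^esub> a = \<one>\<^bsub>R\<^esub>" using unit_if_notin_max[OF a False] .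
      have ba: "h b \<otimes> h a = \<one>" using b a by (metis hom_mult hom_one)
      have "h b \<otimes> (t [^] i \<otimes> (E \<otimes> t \<oplus> h a)) = t [^] i \<otimes> (h b \<otimes> h a \<ominus> t \<otimes> (\<ominus> (h b \<otimes> E)))"
        using tic Ec tc hom_closed[OF a] hom_closed[OF b(1)] by algebra
      then have "t [^] i \<otimes> (\<one> \<ominus> t \<otimes> (\<ominus> (h b \<otimes> E))) \<in> M"
        using T_M[OF h_T[OF b(1)] rel] by (simp add: ba)
      then show ?thesis using T_neg[OF T_mult[OF h_T[OF b(1)] ET]] by blast
    qed
  qed simp
  then show ?thesis using that by blast
qed

text \<open>Integrality yields t^j (1 - t s) in \<open>M\<close>, which makes e = (t s)^j idempotent
  modulo \<open>M\<close>. If \<open>e\<close> vanishes there, so does t^j; if \<open>e\<close> is 1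
  there, \<open>t\<close> is a unit.\<close>

lemma unit_or_nilpotent_mod_max:
  assumes complete: "adically_complete R \<mm>"
    and p: "Factorial_Ring.prime (p::nat)" "add_pow L p \<one> = \<zero>"
    and t: "t \<in> T" and y: "y \<in> \<mm>" "y \<noteq> \<zero>\<^bsub>R\<^esub>"
  shows "(\<exists>j::nat. t [^] j \<in> M) \<or> (\<exists>s\<in>T. t \<otimes> s \<ominus> \<one> \<in> M)"
proof -
  have tc [simp]: "t \<in> carrier L" using t by (rule T_carrier)
  obtain rs where rs: "set rs \<subseteq> carrier R" "S.eval (\<one> # map h rs) t = \<zero>"
    using integral_relation[OF t y] .
  have rel: "t [^] (0::nat) \<otimes> S.eval (map h (\<one>\<^bsub>R\<^esub> # rs)) t \<in> M"
    using rs(2) h_mem_M[OF m.zero_closed] by simp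
  obtain j :: nat and s where s: "s \<in> T" "t [^] j \<otimes> (\<one> \<ominus> t \<otimes> s) \<in> M"
    by (rule unit_factor[OF t _ _ rel]) (use rs(1) one_notin_max in auto)
  have sc [simp]: "s \<in> carrier L" using s(1) by (rule T_carrier)
  define w where "w = t \<otimes> s"
  have wT: "w \<in> T" using t s(1) by (simp add: w_def T_mult)
  have wc [simp]: "w \<in> carrier L" by (simp add: w_def)
  \<comment> \<open>1 - w^k is a multiple of 1 - w.\<close>
  have stab: "t [^] j \<otimes> (\<one> \<ominus> w [^] k) \<in> M" for k :: nat
  proof (induction k)
    case 0
    then show ?case using h_mem_M[OF m.zero_closed] by (simp add: S.minus_eq S.r_neg)
  next
    case (Suc k)
    have "w [^] k \<in> carrier L" "t [^] j \<in> carrier L" by auto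
    then have "t [^] j \<otimes> (\<one> \<ominus> w [^] k \<otimes> w) =
      t [^] j \<otimes> (\<one> \<ominus> w [^] k) \<oplus> w [^] k \<otimes> (t [^] j \<otimes> (\<one> \<ominus> w))"
      using wc by algebra
    then show ?case
      using M_add[OF Suc T_M[OF T_pow[OF wT, of k] s(2)]] by (simp add: w_def)
  qed
  show ?thesis
  \<comment> \<open>For \<open>j = 0\<close> the element 1 - w itself lies in \<open>M\<close>; a
    positive \<open>j\<close> is what lets \<open>e\<close> be written as a multiple of
    \<open>t\<close>.\<close>
  proof (cases j)
    case 0
    then have "\<ominus> (\<one> \<ominus> w) \<in> M" using stab[of 1] by (simp add: M_neg)
    then have "w \<ominus> \<one> \<in> M" by (simp add: S.minus_eq S.minus_add S.a_comm)
    then show ?thesis using s(1) by (auto simp: w_def)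
  next
    case (Suc j')
    define e where "e = w [^] j"
    have ec: "e \<in> carrier L" by (simp add: e_def)
    have eT: "e \<in> T" using wT by (simp add: e_def T_pow)
    have "t [^] j \<otimes> (\<one> \<ominus> e) \<in> M" using stab by (simp add: e_def)
    then have "\<ominus> (s [^] j) \<otimes> (t [^] j \<otimes> (\<one> \<ominus> e)) \<in> M"
      using T_M T_neg T_pow s(1) by blast
    moreover have "\<ominus> (s [^] j) \<otimes> (t [^] j \<otimes> (\<one> \<ominus> e)) = e \<otimes> e \<ominus> e"
    proof -
      have "e = s [^] j \<otimes> t [^] j" by (simp add: e_def w_def S.nat_pow_distrib S.m_comm)
      then have "\<ominus> (s [^] j) \<otimes> (t [^] j \<otimes> (\<one> \<ominus> e)) = \<ominus> (e \<otimes> (\<one> \<ominus> e))"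
        using ec by (simp add: S.m_assoc[symmetric] S.l_minus)
      also have "\<dots> = e \<otimes> e \<ominus> e" using ec by algebra
      finally show ?thesis .
    qed
    ultimately have "e \<in> M \<or> e \<ominus> \<one> \<in> M"
      using idempotent_mod_max[OF complete p eT] by simp
    then show ?thesis
    proof
      assume eM: "e \<in> M"
      have "t [^] j = t [^] j \<otimes> (\<one> \<ominus> e) \<oplus> t [^] j \<otimes> e"
        using ec S.nat_pow_closed[OF tc, of j] by algebra
      then have "t [^] j \<in> M"
        using M_add[OF stab[of j] T_M[OF T_pow[OF t, of j] eM]] by (simp add: e_def)
      then show ?thesis by blast
    next
      assume "e \<ominus> \<one> \<in> M"
      moreover have "e = t \<otimes> (s \<otimes> w [^] j')" by (simp add: e_def Suc w_def S.m_ac)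
      ultimately show ?thesis using T_mult[OF s(1) T_pow[OF wT, of j']] by auto
    qed
  qed
qed

section \<open>Equality of \<open>T\<close> and R\<close>

lemma T_eq_base:
  assumes closed: "adically_complete R \<mm>" "algebraically_closed (R Quot \<mm>)"
    and p: "Factorial_Ring.prime (p::nat)" "add_pow L p \<one> = \<zero>"
    and frob: "\<And>u. u \<in> carrier L \<Longrightarrow> u [^] p \<in> h ` carrier R \<Longrightarrow> u \<in> h ` carrier R"
    and y: "y \<in> \<mm>" "y \<noteq> \<zero>\<^bsub>R\<^esub>"
  shows "T = h ` carrier R"
proof (intro equalityI subsetI)
  fix f assume f: "f \<in> T"
  have fc [simp]: "f \<in> carrier L" using f by (rule T_carrier)
  have frob_pow: "u \<in> h ` carrier R" if "u [^] (p ^ n) \<in> h ` carrier R" "u \<in> carrier L" for n u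
    using that
  proof (induction n)
    case (Suc n)
    have "(u [^] (p ^ n)) [^] p \<in> h ` carrier R"
      using Suc.prems by (simp add: S.nat_pow_pow mult.commute)
    then have "u [^] (p ^ n) \<in> h ` carrier R"
      by (rule frob[OF S.nat_pow_closed[OF Suc.prems(2)]])
    then show ?case using Suc.prems(2) by (rule Suc.IH)
  qed simp
  define P where
    "P n \<longleftrightarrow> (\<exists>rs. set rs \<subseteq> carrier R \<and> length rs = n \<and> S.eval (\<one> # map h rs) f \<in> M)" for n
  obtain rs0 where "set rs0 \<subseteq> carrier R" "S.eval (\<one> # map h rs0) f = \<zero>"
    using integral_relation[OF f y] .
  then have "P (length rs0)"
    unfolding P_def using h_mem_M[OF m.zero_closed] by (intro exI[of _ rs0]) simp
  then obtain n where n: "P n" "\<forall>k<n. \<not> P k" using exists_least_iff[of P] by blast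
  obtain rs where rs: "set rs \<subseteq> carrier R" "length rs = n" "S.eval (\<one> # map h rs) f \<in> M"
    using n(1) unfolding P_def by (elim exE conjE)
  \<comment> \<open>The monic constant polynomial takes the value 1, which is not in
    \<open>M\<close>, so the minimal degree is positive.\<close>
  have "rs \<noteq> []" using rs(3) one_notin_M by auto
  then obtain c where c: "c \<in> carrier R" "R.eval (\<one>\<^bsub>R\<^esub> # rs) c \<in> \<mm>"
    using residue_root[OF closed(2) rs(1)] by blast
  obtain bs where bs: "set bs \<subseteq> carrier R" "length bs < length rs" and
    ev: "S.eval (\<one> # map h rs) f =
      (f \<ominus> h c) \<otimes> S.eval (\<one> # map h bs) f \<oplus> h (R.eval (\<one>\<^bsub>R\<^esub> # rs) c)"
    using divide_linear[OF rs(1) \<open>rs \<noteq> []\<close> c(1)] fc by metis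
  define t where "t = f \<ominus> h c"
  define g where "g = S.eval (\<one> # map h bs) f"
  have tT: "t \<in> T" using f c(1) by (simp add: t_def T_minus h_T)
  have tc: "t \<in> carrier L" using tT by (rule T_carrier)
  have gT: "g \<in> T" using T_eval[OF f, of "\<one>\<^bsub>R\<^esub> # bs"] bs(1) by (simp add: g_def)
  have gc: "g \<in> carrier L" using gT by (rule T_carrier)
  have tg: "t \<otimes> g \<in> M"
    using rs(3) add_mem_M_iff[OF h_mem_M[OF c(2)], of "t \<otimes> g"] tc gc unfolding ev t_def g_def by simp
  \<comment> \<open>The quotient by X - c is monic of smaller degree, so minimality forbids its
    value to lie in \<open>M\<close>. Hence \<open>t\<close> is a zero divisor modulo
    \<open>M\<close>.\<close>
  have g: "g \<notin> M" using n(2) bs rs(2) unfolding P_def g_def by blast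
  have "\<not> (\<exists>s\<in>T. t \<otimes> s \<ominus> \<one> \<in> M)"
  proof
    assume "\<exists>s\<in>T. t \<otimes> s \<ominus> \<one> \<in> M"
    then obtain s where s: "s \<in> T" "t \<otimes> s \<ominus> \<one> \<in> M" by blast
    have "g = s \<otimes> (t \<otimes> g) \<ominus> g \<otimes> (t \<otimes> s \<ominus> \<one>)"
      using T_carrier[OF s(1)] tc gc by algebra
    then show False using M_minus[OF T_M[OF s(1) tg] T_M[OF gT s(2)]] g by simp
  qed
  then obtain j :: nat where j: "t [^] j \<in> M"
    using unit_or_nilpotent_mod_max[OF closed(1) p tT y] by blast
  \<comment> \<open>Raising the exponent from \<open>j\<close> to a power of \<open>p\<close> keeps
    the result in \<open>M\<close> and makes \<open>frob_pow\<close> applicable.\<close>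
  have "j \<le> p ^ j"
    using prime_gt_1_nat[OF p(1)] by (simp add: less_imp_le power_gt_expt)
  then have "t [^] (p ^ j) = t [^] (p ^ j - j) \<otimes> t [^] j" using tc by (simp add: S.nat_pow_mult)
  then have "t [^] (p ^ j) \<in> h ` carrier R" using T_M[OF T_pow[OF tT] j] M_subset by auto
  then have "t \<in> h ` carrier R" using frob_pow tc by blast
  then obtain r where r: "r \<in> carrier R" "t = h r" by blast
  have "f = t \<oplus> h c" using c(1) by (simp add: t_def S.minus_eq S.a_assoc S.l_neg)
  then have "f = h (r \<oplus>\<^bsub>R\<^esub> c)" using r c(1) by simp
  then show "f \<in> h ` carrier R" using r(1) c(1) by blast
qed (auto simp: h_T)

end

section \<open>Regularity\<close>

theorem proposition4p5:
  fixes R :: "('a, 'b) ring_scheme" and \<mm> :: "'a set" and p :: nat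
  assumes "noetherian_local_ring R \<mm>"
    and "adically_complete R \<mm>"
    and "Factorial_Ring.prime p" and "has_char R p"
    and "F_injective R \<mm> p"
    and "krull_dim R = 1"
    and "algebraically_closed (R Quot \<mm>)"
    and "domain R"
  shows "regular_local_ring R \<mm>"
proof -
  interpret noetherian_local_ring R \<mm> by fact
  interpret domain R by fact
  have max_ideal: "ideal \<mm> R" using maximal by (rule maximalideal.axioms(1))
  obtain xs where xs: "system_of_parameters R \<mm> xs"
    and inj: "\<And>i. inj_on (cohomology_frobenius R p xs i) (carrier (cech_cohomology R xs i))"
    using assms(5) unfolding F_injective_def by blast
  have "length xs = 1"
    using xs assms(6) by (simp add: system_of_parameters_def one_enat_def)
  then obtain x where xs_eq: "xs = [x]" by (metis One_nat_def length_0_conv length_Suc_conv)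
  have "x \<in> \<mm>" using xs by (simp add: system_of_parameters_def xs_eq)
  then have xc: "x \<in> carrier R" using ideal.Icarr[OF max_ideal] by blast
  obtain n where n: "ideal_power R \<mm> n \<subseteq> PIdl\<^bsub>R\<^esub> x"
    using xs cgenideal_eq_genideal[OF xc] by (auto simp: system_of_parameters_def xs_eq)
  have "\<exists>y\<in>carrier R. \<mm> = PIdl\<^bsub>R\<^esub> y"
  proof (cases "\<mm> \<subseteq> PIdl\<^bsub>R\<^esub> x")
    case True
    then show ?thesis using cgenideal_minimal[OF max_ideal \<open>x \<in> \<mm>\<close>] xc by blast
  next
    case False
    then obtain b where bc [simp]: "b \<in> carrier R" and b: "b \<notin> PIdl\<^bsub>R\<^esub> x"
      "\<And>z. z \<in> \<mm> \<Longrightarrow> b \<otimes>\<^bsub>R\<^esub> z \<in> PIdl\<^bsub>R\<^esub> x"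
      using power_conductor[OF cgenideal_ideal[OF xc] n] by blast
    have b0: "b \<noteq> \<zero>\<^bsub>R\<^esub>"
      using b(1) additive_subgroup.zero_closed[OF ideal.axioms(1)[OF cgenideal_ideal[OF xc]]] by blast
    \<comment> \<open>If \<open>x\<close> were zero, \<open>b\<close> would annihilate
      \<open>\<mm>\<close>, so \<open>\<mm>\<close> would be zero and contained in the ideal of
      \<open>x\<close>.\<close>
    have x0: "x \<noteq> \<zero>\<^bsub>R\<^esub>"
    proof
      assume x: "x = \<zero>\<^bsub>R\<^esub>"
      have "z = \<zero>\<^bsub>R\<^esub>" if "z \<in> \<mm>" for z
        using b(2)[OF that] b0 ideal.Icarr[OF max_ideal that]
        by (auto simp: x cgenideal_def integral_iff)
      then show False
        using False additive_subgroup.zero_closed[OF ideal.axioms(1)[OF cgenideal_ideal[OF xc]]] by blast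
    qed
    interpret loc: domain_localization R x by unfold_locales (fact xc x0)+
    interpret loc: local_extension "localization R x" R \<mm> loc.of_base
      by (intro local_extension.intro local_extension_axioms.intro loc.ring_hom_of_base
          loc.domain_localization loc.inj_of_base assms(1))
    have "add_pow R p \<one>\<^bsub>R\<^esub> = \<zero>\<^bsub>R\<^esub>" using assms(4) by (simp add: has_char_def)
    then have char: "add_pow (localization R x) p \<one>\<^bsub>localization R x\<^esub> = \<zero>\<^bsub>localization R x\<^esub>"
      using loc.hom_add_pow_one[of p] loc.hom_zero by simp
    have T: "loc.T = loc.of_base ` carrier R"
    proof (rule loc.T_eq_base[OF assms(2,7,3) char _ \<open>x \<in> \<mm>\<close> x0])
      fix u assume "u \<in> carrier (localization R x)"
        "u [^]\<^bsub>localization R x\<^esub> p \<in> loc.of_base ` carrier R"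
      then show "u \<in> loc.of_base ` carrier R"
        using loc.frobenius_closed_base[OF _ assms(3) char] inj[of "Suc 0"] unfolding xs_eq by blast
    qed
    let ?f = "loc_frac R x b 1"
    have fz: "?f \<otimes>\<^bsub>localization R x\<^esub> loc.of_base z = loc.of_base r"
      if "b \<otimes>\<^bsub>R\<^esub> z = r \<otimes>\<^bsub>R\<^esub> x" "z \<in> carrier R" "r \<in> carrier R" for z r
      using that xc by (simp add: loc.of_base_def loc.loc_frac_simps m_comm)
    have "?f \<notin> loc.T"
    proof
      assume "?f \<in> loc.T"
      then obtain c where c: "c \<in> carrier R" "?f = loc.of_base c" unfolding T by blast
      then have "b = c \<otimes>\<^bsub>R\<^esub> x" using xc by (simp add: loc.of_base_def loc.loc_frac_eq_iff m_comm)
      then show False using b(1) c(1) unfolding cgenideal_def by blast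
    qed
    \<comment> \<open>As b/x does not stabilize \<open>\<mm>\<close>, some r = (b/x) z in R falls
      outside \<open>\<mm>\<close> and is a unit.\<close>
    then obtain z where z: "z \<in> \<mm>" "?f \<otimes>\<^bsub>localization R x\<^esub> loc.of_base z \<notin> loc.M"
      unfolding loc.T_def loc.M_def by auto
    have zc [simp]: "z \<in> carrier R" using z(1) ideal.Icarr[OF max_ideal] by blast
    obtain r where r: "r \<in> carrier R" "b \<otimes>\<^bsub>R\<^esub> z = r \<otimes>\<^bsub>R\<^esub> x"
      using b(2)[OF z(1)] unfolding cgenideal_def by blast
    have "r \<notin> \<mm>" using z(2) fz[OF r(2) zc r(1)] loc.h_mem_M by metis
    then obtain s where s: "s \<in> carrier R" "s \<otimes>\<^bsub>R\<^esub> r = \<one>\<^bsub>R\<^esub>"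
      using unit_if_notin_max[OF r(1)] by blast
    \<comment> \<open>With \<open>s\<close> the inverse of \<open>r\<close>, this is the fraction
      x/b, now known to lie in \<open>\<mm>\<close>.\<close>
    define y where "y = s \<otimes>\<^bsub>R\<^esub> z"
    have y: "y \<in> \<mm>" unfolding y_def by (rule ideal.I_l_closed[OF max_ideal z(1) s(1)])
    have yc: "y \<in> carrier R" using s(1) by (simp add: y_def)
    have by_eq: "b \<otimes>\<^bsub>R\<^esub> y = x"
    proof -
      have "b \<otimes>\<^bsub>R\<^esub> y = s \<otimes>\<^bsub>R\<^esub> (r \<otimes>\<^bsub>R\<^esub> x)"
        unfolding y_def r(2)[symmetric] using s(1) by (simp add: m_lcomm)
      also have "\<dots> = x" using s r(1) xc by (simp add: m_assoc[symmetric])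
      finally show ?thesis .
    qed
    have "w \<in> PIdl\<^bsub>R\<^esub> y" if w: "w \<in> \<mm>" for w
    proof -
      have wc: "w \<in> carrier R" using w ideal.Icarr[OF max_ideal] by blast
      obtain q where q: "q \<in> carrier R" "b \<otimes>\<^bsub>R\<^esub> w = q \<otimes>\<^bsub>R\<^esub> x"
        using b(2)[OF w] unfolding cgenideal_def by blast
      \<comment> \<open>Replacing \<open>x\<close> by b y in the equation for b w leaves a common
        factor \<open>b\<close> to cancel.\<close>
      have "b \<otimes>\<^bsub>R\<^esub> w = b \<otimes>\<^bsub>R\<^esub> (q \<otimes>\<^bsub>R\<^esub> y)"
        unfolding q(2) by_eq[symmetric] using q(1) yc by (simp add: m_lcomm)
      then have "w = q \<otimes>\<^bsub>R\<^esub> y" using m_lcancel[OF b0 bc wc, of "q \<otimes>\<^bsub>R\<^esub> y"] q(1) yc by simp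
      then show ?thesis using q(1) unfolding cgenideal_def by blast
    qed
    then show ?thesis using cgenideal_minimal[OF max_ideal y] yc by blast
  qed
  then obtain y where y: "y \<in> carrier R" "\<mm> = Idl\<^bsub>R\<^esub> {y}"
    using cgenideal_eq_genideal by auto
  show ?thesis
    unfolding regular_local_ring_def
  proof (intro conjI exI[of _ "{y}"])
    show "noetherian_local_ring R \<mm>" by fact
    show "enat (card {y}) = krull_dim R" using assms(6) by (simp add: one_enat_def)
  qed (use y in auto)
qed

end
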